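(* Let $k$ be an odd positive integer, let $n=2k$, let $\xi$ be a primitive element of $\mathbb{F}_{3^n}$ (a generator of the multiplicative group $\mathbb{F}_{3^n}^*$), and let $a=\xi^{\frac{3^k+1}{4}}$. Then the function $f:\mathbb{F}_{3^n}\to\mathbb{F}_3$ defined by $$f(x)=\operatorname{Tr}_n\Big(a x^{\frac{3^n-1}{4}+3^k+1}\Big),\quad x\in\mathbb{F}_{3^n},$$ is a weakly regular bent function.
   Context: $\mathbb{F}_{3^n}$ denotes the finite field with $3^n$ elements and $\operatorname{Tr}_n:\mathbb{F}_{3^n}\to\mathbb{F}_3$ the absolute trace. Let $\omega=e^{2\pi i/3}$; elements of $\mathbb{F}_3$ are regarded as integers modulo $3$ when used as exponents of $\omega$. For $f:\mathbb{F}_{3^n}\to\mathbb{F}_3$ and $b\in\mathbb{F}_{3^n}$, the Walsh coefficient of $f$ at $b$ is $S_f(b)=\sum_{x\in\mathbb{F}_{3^n}}\omega^{f(x)-\operatorname{Tr}_n(bx)}$. The function $f$ is (ternary) bent if $|S_f(b)|^2=3^n$ for all $b\in\mathbb{F}_{3^n}$. A bent function $f$ is weakly regular if there exist a complex number $u$ with $|u|=1$ and a function $f^*:\mathbb{F}_{3^n}\to\mathbb{F}_3$ such that $u\,3^{-n/2}S_f(b)=\omega^{f^*(b)}$ for all $b\in\mathbb{F}_{3^n}$. *)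

theory Defs
  imports Complex_Main "HOL-Library.Numeral_Type" "HOL-Number_Theory.Number_Theory"
begin

text \<open>
  The prime field is the numeral type \<^typ>\<open>3\<close> (integers modulo 3), with
  \<^const>\<open>Rep_bit1\<close> giving the representative in $\{0,1,2\}$.  The field with $3^n$
  elements is an arbitrary type of class \<^class>\<open>finite_field\<close> of that cardinality.
\<close>

definition of_F3 :: "3 \<Rightarrow> 'a::field" where
  "of_F3 c = of_int (Rep_bit1 c)"

text \<open>
  \<open>absolute_trace n x\<close> is $x + x^3 + \dots + x^{3^{n-1}}$ read as an element of the prime
  field; see \<open>of_F3_absolute_trace\<close> below for well-definedness.
\<close>

definition absolute_trace :: "nat \<Rightarrow> 'a::field \<Rightarrow> 3" where
  "absolute_trace n x = (THE c. of_F3 c = (\<Sum>i<n. x ^ (3 ^ i)))"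

definition primitive_element :: "'a::field \<Rightarrow> bool" where
  "primitive_element g \<longleftrightarrow> g \<noteq> 0 \<and> range (\<lambda>i::int. g powi i) = UNIV - {0}"

definition omega :: complex where
  "omega = exp (2 * of_real pi * \<i> / 3)"

definition omega_pow :: "3 \<Rightarrow> complex" where
  "omega_pow c = omega powi Rep_bit1 c"

definition walsh :: "nat \<Rightarrow> ('a::finite_field \<Rightarrow> 3) \<Rightarrow> 'a \<Rightarrow> complex" where
  "walsh n f b = (\<Sum>x\<in>UNIV. omega_pow (f x - absolute_trace n (b * x)))"

definition bent :: "nat \<Rightarrow> ('a::finite_field \<Rightarrow> 3) \<Rightarrow> bool" where
  "bent n f \<longleftrightarrow> (\<forall>b. (cmod (walsh n f b))\<^sup>2 = 3 ^ n)"

definition weakly_regular_bent :: "nat \<Rightarrow> ('a::finite_field \<Rightarrow> 3) \<Rightarrow> bool" where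
  "weakly_regular_bent n f \<longleftrightarrow> bent n f \<and>
     (\<exists>u fstar. cmod u = 1 \<and>
        (\<forall>b. u * of_real (3 powr (- (real n / 2))) * walsh n f b = omega_pow (fstar b)))"

lemma CHAR_eq_3:
  assumes "CARD('a::finite_field) = 3 ^ n"
  shows "CHAR('a) = 3"
proof -
  have "prime CHAR('a)" by simp
  moreover have "CHAR('a) dvd 3 ^ n" using CHAR_dvd_CARD[where 'a = 'a] assms by simp
  ultimately have "CHAR('a) dvd 3" using prime_dvd_power by blast
  thus ?thesis using \<open>prime CHAR('a)\<close> by (simp add: primes_dvd_imp_eq)
qed

lemma inj_of_F3:
  assumes "CARD('a::finite_field) = 3 ^ n"
  shows "inj (of_F3 :: 3 \<Rightarrow> 'a)"
proof (rule injI)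
  fix c d :: 3
  assume "of_F3 c = (of_F3 d :: 'a)"
  hence "[Rep_bit1 c = Rep_bit1 d] (mod 3)"
    using CHAR_eq_3[OF assms] by (simp add: of_F3_def of_int_eq_iff_cong_CHAR)
  moreover have "Rep_bit1 c \<in> {0..<3}" "Rep_bit1 d \<in> {0..<3}"
    using Rep_bit1[of c] Rep_bit1[of d] by auto
  ultimately show "c = d"
    by (simp add: cong_def Rep_bit1_inject)
qed

lemma of_F3_absolute_trace:
  fixes x :: "'a::finite_field"
  assumes card: "CARD('a) = 3 ^ n"
  shows "of_F3 (absolute_trace n x) = (\<Sum>i<n. x ^ (3 ^ i))"
proof -
  define s where "s = (\<Sum>i<n. x ^ (3 ^ i))"
  have char: "CHAR('a) = 3" by (rule CHAR_eq_3[OF card])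
  have xq: "x ^ 3 ^ n = x"
    using finite_field_power_card_eq_same[of x] card by simp
  have pw: "(x ^ 3 ^ i) ^ 3 = x ^ 3 ^ Suc i" for i
    by (simp add: power_mult [symmetric] mult.commute)
  have "s ^ 3 = (\<Sum>i<n. (x ^ 3 ^ i) ^ 3)"
    unfolding s_def by (rule freshmans_dream_sum) (simp_all add: char)
  also have "\<dots> = (\<Sum>i<n. x ^ 3 ^ Suc i)" by (simp only: pw)
  finally have "s ^ 3 + x = (\<Sum>i<Suc n. x ^ 3 ^ i)"
    unfolding sum.lessThan_Suc_shift by simp
  also have "\<dots> = s + x" unfolding s_def by (simp add: xq)
  finally have "s ^ 3 = s" by simp
  moreover have "s * (s - 1) * (s + 1) = s ^ 3 - s"
    by (simp add: algebra_simps power3_eq_cube)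
  ultimately have "s * (s - 1) * (s + 1) = 0" by simp
  hence "s = of_int 0 \<or> s = of_int 1 \<or> s = of_int (- 1)"
    by (simp add: eq_neg_iff_add_eq_0)
  moreover have "of_int (- 1) = (of_int 2 :: 'a)"
    unfolding of_int_eq_iff_cong_CHAR char by (simp add: cong_def)
  ultimately have "s = of_int 0 \<or> s = of_int 1 \<or> s = of_int 2" by argo
  then obtain m :: int where m: "s = of_int m" "m \<in> {0..<3}"
    by (elim disjE) (rule that, assumption, simp)+
  have "Rep_bit1 (Abs_bit1 m :: 3) = m"
    using m(2) by (intro Abs_bit1_inverse) simp
  hence "of_F3 (Abs_bit1 m :: 3) = s"
    unfolding of_F3_def m(1) by simp
  hence "\<exists>!c. of_F3 c = s" using inj_of_F3[OF card] by (metis injD)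
  thus ?thesis unfolding absolute_trace_def s_def by (rule theI')
qed

end

theory Submission
  imports Defs "HOL-Computational_Algebra.Polynomial"
begin

text \<open>
  Let $q = 3^k \equiv 3 \pmod 8$, let $K$ be the subfield of order $q$, let
  $\psi(x) = \omega^{\mathrm{Tr}_n(x)}$, and let $\iota = \xi^{(q^2-1)/4}$, so that $a^q = \iota a$.  Hence $f(x)$ depends only on the norm of $x$ and on the quartic character
  $\chi(x) = x^{(q^2-1)/4}$: with $c = a (1 + \iota) \in K$ it is the trace of
  $\pm c N(x)$ down from $K$, the sign being $+$ iff $\chi(x) \in \{1, \iota\}$.

  Splitting $\psi(\pm cN)$ into its even and odd part in the sign, the even part of the Walsh sum is
  elementary.  Averaging the odd part over lines through the origin turns it into quadratic Gauss
  sums over $K$; the classes $\chi = \pm\iota$ cancel by Frobenius symmetry, and on the squares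
  $z = y^2$ everything reduces to a multiple of the real part of
  $\sum_{s \in K} \eta(s) \psi(D (s+1)^2) = \psi(D) V - G(D)$ with $D = N(b)/c$ and
  $V = \sum_{x \in K} \psi(D (x^4 - x^2))$.  In characteristic three
  $x^4 - x^2 = x \cdot x^3 - x^2$ is a quadratic form over the prime field, so $V^2$ is real.
  Together with the symmetry $z \mapsto \iota z$ this leaves just enough freedom for a sign,
  and the Walsh coefficient is $- q \psi(D)$ or $- q \psi(-D)$.
\<close>

subsection \<open>Cube roots of unity and the absolute trace\<close>

lemma power_int_div_mod:
  fixes x :: "'a::field"
  assumes "x \<noteq> 0"
  shows "x powi i = (x ^ e) powi (i div int e) * x powi (i mod int e)"
  using power_int_add[of x "int e * (i div int e)" "i mod int e"] assms
    power_int_mult[of x "int e" "i div int e"] by simp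

lemma omega_eq_cis: "omega = cis (2 * pi / 3)"
  by (simp add: omega_def cis_conv_exp mult_ac)

lemma omega_cube: "omega ^ 3 = 1"
  unfolding omega_eq_cis DeMoivre by simp

lemma omega_neq: "omega \<noteq> 1" "omega ^ 2 \<noteq> 1" "omega \<noteq> 0"
proof -
  have "cos (2 * (pi / 3)) = - 1 / 2"
    unfolding cos_double_cos by (simp add: cos_60 power2_eq_square)
  hence "Re omega = - 1 / 2" by (simp add: omega_eq_cis)
  thus *: "omega \<noteq> 1" by auto
  show "omega \<noteq> 0" by (simp add: omega_def)
  have "omega ^ 3 = omega ^ 2 * omega" by (simp add: power2_eq_square power3_eq_cube)
  thus "omega ^ 2 \<noteq> 1" using omega_cube * by auto
qed

lemma omega_powi_mod: "omega powi (i mod 3) = omega powi i"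
  using power_int_div_mod[of omega i 3] omega_neq omega_cube by simp

lemma Rep_bit1_add: "Rep_bit1 (c + d :: 3) = (Rep_bit1 c + Rep_bit1 d) mod 3"
  using bit1.Rep_Abs_mod[of "Rep_bit1 c + Rep_bit1 d", where 'a = num1] by (simp add: bit1.add_def)

lemma omega_pow_add: "omega_pow (c + d) = omega_pow c * omega_pow d"
  using omega_neq by (simp add: omega_pow_def Rep_bit1_add omega_powi_mod power_int_add)

lemma omega_pow_0: "omega_pow 0 = 1"
  by (simp add: omega_pow_def bit1.Rep_0)

lemma omega_pow_eq_1_iff: "omega_pow c = 1 \<longleftrightarrow> c = 0"
proof
  assume *: "omega_pow c = 1"
  have "Rep_bit1 c \<in> {0..<3}" using Rep_bit1[of c] by simp
  hence "Rep_bit1 c = 0 \<or> Rep_bit1 c = 1 \<or> Rep_bit1 c = 2" by auto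
  hence "Rep_bit1 c = 0" using * omega_neq by (auto simp: omega_pow_def)
  thus "c = 0" by (simp add: bit1.Rep_inject_sym bit1.Rep_0)
qed (simp add: omega_pow_0)

context
  fixes n :: nat
  assumes card: "CARD('a::finite_field) = 3 ^ n"
begin

lemma of_F3_add: "(of_F3 (c + d) :: 'a) = of_F3 c + of_F3 d"
proof -
  have "(of_int ((Rep_bit1 c + Rep_bit1 d) mod 3) :: 'a) = of_int (Rep_bit1 c + Rep_bit1 d)"
    unfolding of_int_eq_iff_cong_CHAR CHAR_eq_3[OF card] by (simp add: cong_def)
  thus ?thesis by (simp add: of_F3_def Rep_bit1_add)
qed

lemma absolute_trace_add: "absolute_trace n (x + y :: 'a) = absolute_trace n x + absolute_trace n y"
proof -
  have "(x + y) ^ 3 ^ i = x ^ 3 ^ i + y ^ 3 ^ i" for i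
    by (rule freshmans_dream'[where n = i]) (simp_all add: CHAR_eq_3[OF card])
  hence "(of_F3 (absolute_trace n (x + y)) :: 'a) = of_F3 (absolute_trace n x + absolute_trace n y)"
    by (simp add: of_F3_absolute_trace[OF card] of_F3_add sum.distrib)
  thus ?thesis using inj_of_F3[OF card] by (simp add: inj_eq)
qed

lemma absolute_trace_cube: "absolute_trace n (x ^ 3 :: 'a) = absolute_trace n x"
proof -
  have "(\<Sum>i<n. (x ^ 3) ^ 3 ^ i) + x = (\<Sum>i<Suc n. x ^ 3 ^ i)"
    unfolding sum.lessThan_Suc_shift by (simp flip: power_mult)
  also have "\<dots> = (\<Sum>i<n. x ^ 3 ^ i) + x"
    using finite_field_power_card_eq_same[of x] card by simp
  finally have "(of_F3 (absolute_trace n (x ^ 3)) :: 'a) = of_F3 (absolute_trace n x)"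
    by (simp add: of_F3_absolute_trace[OF card])
  thus ?thesis using inj_of_F3[OF card] by (simp add: inj_eq)
qed

text \<open>As a polynomial the trace has linear coefficient 1 and degree at most
  \<open>3 ^ (n - 1)\<close>, so it has too few roots to vanish on the whole field.\<close>

lemma absolute_trace_nontrivial:
  assumes "n > 0"
  shows "\<exists>x::'a. absolute_trace n x \<noteq> 0"
proof (rule ccontr)
  assume "\<not> ?thesis"
  hence "of_F3 (absolute_trace n x) = (0 :: 'a)" for x :: 'a
    by (simp add: of_F3_def bit1.Rep_0)
  hence zero: "(\<Sum>i<n. x ^ 3 ^ i) = 0" for x :: 'a
    by (simp add: of_F3_absolute_trace[OF card])
  define p :: "'a poly" where "p = (\<Sum>i<n. monom 1 (3 ^ i))"
  have "coeff p 1 = (\<Sum>i<n. if i = 0 then 1 else 0)"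
    unfolding p_def coeff_sum by (intro sum.cong) auto
  also have "\<dots> = 1" using assms by simp
  finally have "p \<noteq> 0" by auto
  have "degree p \<le> 3 ^ (n - 1)"
    unfolding p_def
  proof (rule degree_sum_le)
    fix i assume "i \<in> {..<n}"
    hence "i \<le> n - 1" by auto
    thus "degree (monom (1::'a) (3 ^ i)) \<le> 3 ^ (n - 1)"
      by (simp add: degree_monom_eq)
  qed simp
  moreover have "poly p x = 0" for x
    by (simp add: p_def poly_sum poly_monom zero)
  hence "CARD('a) \<le> degree p" using card_poly_roots_bound[OF \<open>p \<noteq> 0\<close>] by simp
  moreover have "(3::nat) ^ (n - 1) < 3 ^ n" using assms by simp
  ultimately show False unfolding card by linarith
qed

end

text \<open>If \<xi>^e = 1, exponents count only modulo \<open>e\<close>, so the powers of \<xi>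
  take at most \<open>e\<close> values, too few to exhaust the nonzero elements.\<close>

lemma primitive_element_power_neq_1:
  fixes \<xi> :: "'a::finite_field"
  assumes "primitive_element \<xi>" "0 < e" "e < CARD('a) - 1"
  shows "\<xi> ^ e \<noteq> 1"
proof
  assume e: "\<xi> ^ e = 1"
  have "\<xi> \<noteq> 0" using assms(1) by (simp add: primitive_element_def)
  have "range (\<lambda>i::int. \<xi> powi i) \<subseteq> (\<lambda>j. \<xi> ^ j) ` {..<e}"
  proof clarify
    fix i :: int
    have "\<xi> powi i = (\<xi> ^ e) powi (i div int e) * \<xi> powi (i mod int e)"
      using \<open>\<xi> \<noteq> 0\<close> by (rule power_int_div_mod)
    also have "\<dots> = \<xi> powi int (nat (i mod int e))" using e assms(2) by simp
    also have "\<dots> = \<xi> ^ nat (i mod int e)" by (rule power_int_of_nat)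
    finally show "\<xi> powi i \<in> (\<lambda>j. \<xi> ^ j) ` {..<e}"
      using assms(2) by (auto simp: nat_less_iff)
  qed
  hence "card (UNIV - {0 :: 'a}) \<le> card ((\<lambda>j. \<xi> ^ j) ` {..<e})"
    using assms(1) unfolding primitive_element_def by (intro card_mono) auto
  also have "\<dots> \<le> e" using card_image_le[of "{..<e}" "\<lambda>j. \<xi> ^ j"] by simp
  finally show False using assms(3) by (simp add: card_Diff_singleton)
qed

text \<open>Powers of 9 are 1 modulo 8. Writing q = 8m + 3 turns (q+1)/4 and (q-1)/2 into the odd
  numbers 2m + 1 and 4m + 1, the exponents used throughout.\<close>

lemma three_power_odd:
  assumes "odd k"
  obtains m where "(3::nat) ^ k = 8 * m + 3"
proof -
  obtain j where k: "k = 2 * j + 1" using assms by (elim oddE)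
  have "\<exists>m. (9::nat) ^ j = 8 * m + 1"
  proof (induction j)
    case (Suc j)
    then obtain m where "(9::nat) ^ j = 8 * m + 1" by blast
    hence "(9::nat) ^ Suc j = 8 * (9 * m + 1) + 1" by simp
    thus ?case by blast
  qed simp
  then obtain m where "(9::nat) ^ j = 8 * m + 1" by blast
  hence "(3::nat) ^ k = 8 * (3 * m) + 3" by (simp add: k power_mult)
  thus thesis by (rule that)
qed

text \<open>To be applied with \<open>e\<close> = \<psi>(D), \<open>V\<close> the quartic sum,
  \<open>G\<close> a Gauss sum. Whether \<open>V\<close> is real or imaginary, \<open>refl\<close>
  becomes a linear relation between \<open>V\<close> and \<open>G\<close>, namely (1 + e) V = (1 -
  e) G or V = -G, and each determines twice the real part of \<open>Z\<close>.\<close>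

lemma cube_root_identity:
  fixes e G V Z :: complex
  assumes e: "e ^ 2 + e + 1 = 0" and ce: "cnj e = e ^ 2" and Z: "Z = e * V - G"
    and refl: "Z = - e * cnj Z" and V: "cnj V = V \<or> cnj V = - V" and G: "cnj G = - G"
  shows "Z + cnj Z = (e - e ^ 2) * G \<or> Z + cnj Z = - (e - e ^ 2) * G"
proof -
  have cZ: "cnj Z = e ^ 2 * cnj V + G" by (simp add: Z ce G)
  have eq: "e * V - G = - e * (e ^ 2 * cnj V + G)" using refl unfolding cZ unfolding Z .
  have "e ^ 3 - 1 = (e - 1) * (e ^ 2 + e + 1)"
    by (simp add: algebra_simps power2_eq_square power3_eq_cube)
  hence e3: "e ^ 3 = 1" by (simp add: e)
  from V show ?thesis
  proof
    assume V: "cnj V = V"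
    have "e * V - G = - (e ^ 3) * V - e * G"
      using eq unfolding V by (simp add: algebra_simps power2_eq_square power3_eq_cube)
    hence 1: "e * V - G = - V - e * G" by (simp add: e3)
    have "V + e * V = (e * V - G) + V + G" by simp
    also have "\<dots> = G - e * G" unfolding 1 by simp
    finally have "e * (V + e * V) = e * (G - e * G)" by (rule arg_cong)
    hence "e * V - G + (e ^ 2 * V + G) = (e - e ^ 2) * G"
      by (simp add: algebra_simps power2_eq_square)
    thus ?thesis using cZ Z V by simp
  next
    assume V: "cnj V = - V"
    have "e * V - G = e ^ 3 * V - e * G"
      using eq unfolding V by (simp add: algebra_simps power2_eq_square power3_eq_cube)
    hence 1: "e * V - G = V - e * G" by (simp add: e3)
    have "(e - 1) * (V + G) = (e * V - G) - V + e * G" by (simp add: algebra_simps)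
    hence "(e - 1) * (V + G) = 0" unfolding 1 by simp
    moreover have "e \<noteq> 1" using e by auto
    ultimately have "V = - G" by (simp add: add_eq_0_iff2)
    hence "Z + cnj Z = - (e - e ^ 2) * G"
      unfolding cZ unfolding Z V by (simp add: algebra_simps)
    thus ?thesis ..
  qed
qed

text \<open>Identities special to characteristic three are reduced to ring identities: each later
  witness \<open>X\<close> is the formal difference of the two sides divided by 3.\<close>

lemma char_3I:
  fixes l r X :: "'a::comm_ring_1"
  assumes "(3::'a) = 0" "l - r = 3 * X"
  shows "l = r"
  using assms by simp

subsection \<open>A quadratic extension in characteristic three\<close>

text \<open>What the sums need of the character x -> \<omega>^Tr(x): it is additive, nontrivial and
  invariant under cubing, hence under the q-Frobenius.\<close>

locale ternary_character =
  fixes k m q :: nat and \<iota> :: "'a::finite_field" and \<psi> :: "'a \<Rightarrow> complex"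
  assumes q_def: "q = 3 ^ k" and q_mod: "q = 8 * m + 3"
    and card_UNIV_eq: "CARD('a) = q ^ 2"
    and i_sq: "\<iota> ^ 2 = -1"
    and psi_add: "\<psi> (x + y) = \<psi> x * \<psi> y"
    and psi_zero: "\<psi> 0 = 1"
    and psi_cube: "\<psi> (x ^ 3) = \<psi> x"
    and psi_nontrivial: "\<exists>x. \<psi> x \<noteq> 1"
begin

lemma CHAR_3: "CHAR('a) = 3"
  using CHAR_eq_3[of "2 * k", where 'a = 'a] card_UNIV_eq q_def
  by (simp add: power_mult mult.commute)

lemma three_eq_0: "(3::'a) = 0"
  using of_nat_CHAR[where 'a = 'a] by (simp add: CHAR_3)

lemmas char3 = char_3I[OF three_eq_0]

lemma two_eq: "(2::'a) = -1"
  by (rule char3[where X = 1]) simp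

lemma one_neq_minus_one: "(1::'a) \<noteq> -1"
proof
  assume "(1::'a) = -1"
  hence "(2::'a) = 0" by (metis add.right_inverse one_add_one)
  thus False by (simp add: two_eq)
qed

lemma odd_q: "odd q" by (simp add: q_mod)

lemma frob_add: "(x + y :: 'a) ^ q = x ^ q + y ^ q"
  by (rule freshmans_dream'[where n = k]) (simp_all add: CHAR_3 q_def)

lemma frob_minus: "(- x :: 'a) ^ q = - (x ^ q)"
  using odd_q by simp

lemma frob_diff: "(x - y :: 'a) ^ q = x ^ q - y ^ q"
  using frob_add[of x "- y"] by (simp add: frob_minus)

lemma frob_frob: "((x::'a) ^ q) ^ q = x"
  using finite_field_power_card_eq_same[of x]
  by (simp add: card_UNIV_eq power2_eq_square power_mult)

section \<open>The subfield of order q, relative norm and trace, and coordinates over it\<close>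

definition K :: "'a set" where "K = {x. x ^ q = x}"
definition Nm :: "'a \<Rightarrow> 'a" where "Nm x = x * x ^ q"
definition Tr :: "'a \<Rightarrow> 'a" where "Tr x = x + x ^ q"

lemma K_0: "0 \<in> K" and K_1: "1 \<in> K"
  using odd_q by (auto simp: K_def power_0_left intro: Nat.gr0I)

lemma K_add: "x \<in> K \<Longrightarrow> y \<in> K \<Longrightarrow> x + y \<in> K"
  and K_diff: "x \<in> K \<Longrightarrow> y \<in> K \<Longrightarrow> x - y \<in> K"
  and K_minus: "x \<in> K \<Longrightarrow> - x \<in> K"
  and K_mult: "x \<in> K \<Longrightarrow> y \<in> K \<Longrightarrow> x * y \<in> K"
  and K_divide: "x \<in> K \<Longrightarrow> y \<in> K \<Longrightarrow> x / y \<in> K"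
  by (simp_all add: K_def frob_add frob_diff frob_minus power_mult_distrib power_divide)

lemma K_power: "x \<in> K \<Longrightarrow> x ^ j \<in> K"
  by (induction j) (simp_all add: K_1 K_mult)

lemma K_Nm: "Nm x \<in> K" and K_Tr: "Tr x \<in> K"
  by (simp_all add: K_def Nm_def Tr_def frob_add frob_frob power_mult_distrib)

lemmas K_intros = K_0 K_1 K_add K_diff K_minus K_mult K_divide K_power K_Nm K_Tr

lemma finite_K [simp]: "finite K" by simp

lemma Nm_mult: "Nm (x * y) = Nm x * Nm y"
  by (simp add: Nm_def power_mult_distrib)

lemma Nm_eq_0_iff [simp]: "Nm x = 0 \<longleftrightarrow> x = 0"
  by (auto simp: Nm_def)

lemma Nm_K: "t \<in> K \<Longrightarrow> Nm t = t ^ 2"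
  by (simp add: Nm_def K_def power2_eq_square)

lemma Tr_mult_K: "t \<in> K \<Longrightarrow> Tr (t * x) = t * Tr x"
  by (simp add: Tr_def K_def power_mult_distrib algebra_simps)

lemma i_nz: "\<iota> \<noteq> 0"
  using i_sq by (auto simp: power2_eq_square)

lemma i_pow4: "\<iota> ^ 4 = 1"
  using i_sq power_mult[of \<iota> 2 2] by simp

text \<open>As q is 3 modulo 4, \<iota>^q = \<iota>^3. So \<iota> lies outside \<open>K\<close>, and
  1, \<iota> can serve as a basis over \<open>K\<close>.\<close>

lemma i_frob: "\<iota> ^ q = - \<iota>"
proof -
  have "\<iota> ^ q = (\<iota> ^ 4) ^ (2 * m) * \<iota> ^ 2 * \<iota>"
    by (simp add: q_mod power_add power2_eq_square power3_eq_cube flip: power_mult)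
  thus ?thesis by (simp add: i_pow4 i_sq)
qed

lemma bij_coords: "bij_betw (\<lambda>(x, y). x + y * \<iota>) (K \<times> K) UNIV"
proof -
  \<comment> \<open>Solves z = x + y\<iota>, z^q = x - y\<iota> for the coordinates, with 1/2 = -1
    and 1/(2\<iota>) = \<iota>.\<close>
  define f where "f = (\<lambda>z. (- (z + z ^ q), (z - z ^ q) * \<iota>))"
  have left: "f (x + y * \<iota>) = (x, y)" if "x \<in> K" "y \<in> K" for x y
  proof -
    have *: "(x + y * \<iota>) ^ q = x - y * \<iota>"
      using that by (simp add: K_def frob_add power_mult_distrib i_frob)
    have "- (x + y * \<iota> + (x - y * \<iota>)) = x"
      by (rule char3[where X = "- x"]) simp
    moreover have "(x + y * \<iota> - (x - y * \<iota>)) * \<iota> = 2 * y * \<iota> ^ 2"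
      by (simp add: algebra_simps power2_eq_square)
    hence "(x + y * \<iota> - (x - y * \<iota>)) * \<iota> = y" by (simp add: i_sq two_eq)
    ultimately show ?thesis by (simp only: f_def *)
  qed
  have right: "fst (f z) + snd (f z) * \<iota> = z" for z
  proof -
    have "fst (f z) + snd (f z) * \<iota> = - (z + z ^ q) + (z - z ^ q) * \<iota> ^ 2"
      by (simp add: f_def power2_eq_square)
    also have "\<dots> = z"
      by (rule char3[where X = "- z"]) (simp add: i_sq)
    finally show ?thesis .
  qed
  have "range f \<subseteq> K \<times> K"
    by (auto simp: f_def K_def frob_minus frob_add frob_diff frob_frob power_mult_distrib i_frob
        algebra_simps)
  thus ?thesis
    by (intro bij_betw_byWitness[where f' = f]) (use left right in \<open>auto simp: case_prod_unfold\<close>)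
qed

lemma card_K: "card K = q"
proof -
  have "card K ^ 2 = q ^ 2"
    using bij_betw_same_card[OF bij_coords] by (simp add: card_UNIV_eq power2_eq_square)
  thus ?thesis by simp
qed

lemma sum_coords: "(\<Sum>z\<in>UNIV. h z) = (\<Sum>x\<in>K. \<Sum>y\<in>K. h (x + y * \<iota>))" for h :: "'a \<Rightarrow> complex"
  unfolding sum.cartesian_product
  by (subst sum.reindex_bij_betw[OF bij_coords, symmetric]) (simp add: case_prod_unfold)

lemma coords_nz: "x \<in> K \<Longrightarrow> y \<in> K \<Longrightarrow> x + y * \<iota> = 0 \<longleftrightarrow> x = 0 \<and> y = 0"
  using inj_onD[OF bij_betw_imp_inj_on[OF bij_coords], of "(x, y)" "(0, 0)"] K_0 by auto

lemma Nm_coords: "x \<in> K \<Longrightarrow> y \<in> K \<Longrightarrow> Nm (x + y * \<iota>) = x ^ 2 + y ^ 2"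
proof -
  assume "x \<in> K" "y \<in> K"
  hence "Nm (x + y * \<iota>) = x ^ 2 - y ^ 2 * \<iota> ^ 2"
    by (simp add: K_def Nm_def frob_add power_mult_distrib i_frob algebra_simps power2_eq_square)
  thus ?thesis by (simp add: i_sq)
qed

lemma Tr_coords: "x \<in> K \<Longrightarrow> y \<in> K \<Longrightarrow> Tr (x + y * \<iota>) = - x"
proof -
  assume "x \<in> K" "y \<in> K"
  hence "Tr (x + y * \<iota>) = 2 * x"
    by (simp add: K_def Tr_def frob_add power_mult_distrib i_frob)
  thus ?thesis by (simp add: two_eq)
qed

section \<open>The additive character and its orthogonality on the subfield\<close>

lemma psi_pow3: "\<psi> x ^ 3 = 1"
proof -
  have "\<psi> x ^ 3 = \<psi> (x + x + x)" by (simp only: psi_add power3_eq_cube)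
  also have "x + x + x = 0" by (rule char3[where X = x]) simp
  finally show ?thesis by (simp add: psi_zero)
qed

lemma cmod_psi: "cmod (\<psi> x) = 1"
proof -
  have "cmod (\<psi> x) ^ 3 = 1" using psi_pow3[of x] by (metis norm_one norm_power)
  thus ?thesis using power_eq_imp_eq_base[of "cmod (\<psi> x)" 3 1] by simp
qed

lemma psi_minus: "\<psi> (- x) = cnj (\<psi> x)"
proof -
  have "\<psi> x * \<psi> (- x) = 1" using psi_add[of x "- x"] by (simp add: psi_zero)
  moreover have "\<psi> x * cnj (\<psi> x) = 1"
    using complex_norm_square[of "\<psi> x"] by (simp add: cmod_psi)
  ultimately show ?thesis by (metis mult_left_cancel mult_zero_left zero_neq_one)
qed

lemma psi_diff: "\<psi> (x - y) = \<psi> x * cnj (\<psi> y)"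
  using psi_add[of x "- y"] by (simp add: psi_minus)

lemma psi_minus_mult: "\<psi> (- x) * \<psi> x = 1"
  using psi_add[of "- x" x] by (simp add: psi_zero)

lemma psi_nz: "\<psi> x \<noteq> 0" using cmod_psi[of x] by auto

lemma psi_frob: "\<psi> (x ^ q) = \<psi> x"
proof -
  have "\<psi> (x ^ (3 ^ j)) = \<psi> x" for j
  proof (induction j)
    case (Suc j)
    have "x ^ (3 ^ Suc j) = (x ^ (3 ^ j)) ^ 3" by (simp add: mult.commute flip: power_mult)
    thus ?case using Suc psi_cube by simp
  qed simp
  thus ?thesis by (simp add: q_def)
qed

text \<open>Frobenius invariance makes \<psi>(Tr z) the square of \<psi>(z), and for cube roots of
  unity squaring is inversion. This moves every argument into \<open>K\<close>.\<close>

lemma psi_Tr: "\<psi> z = \<psi> (- Tr z)"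
proof -
  have "\<psi> (- Tr z) = cnj (\<psi> z) * cnj (\<psi> z) * (\<psi> z ^ 3)"
    by (simp add: psi_minus Tr_def psi_diff psi_add psi_frob psi_pow3 del: minus_add_distrib)
  also have "\<dots> = (\<psi> (- z) * \<psi> z) ^ 2 * \<psi> z"
    by (simp add: psi_minus power2_eq_square power3_eq_cube)
  finally show ?thesis by (simp add: psi_minus_mult)
qed

text \<open>By \<open>psi_Tr\<close> the character is nontrivial already on \<open>K\<close>; a
  shift by an element where it differs from 1 then forces the sum to vanish.\<close>

lemma psi_sum_K:
  assumes "c \<in> K" "c \<noteq> 0"
  shows "(\<Sum>t\<in>K. \<psi> (c * t)) = 0"
proof -
  obtain x where "\<psi> x \<noteq> 1" using psi_nontrivial by blast
  hence x: "\<psi> (- Tr x) \<noteq> 1" using psi_Tr by simp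
  define s where "s = - Tr x / c"
  have s: "s \<in> K" "c * s = - Tr x" using assms by (auto simp: s_def intro!: K_intros)
  have "(\<Sum>t\<in>K. \<psi> (c * t)) = (\<Sum>t\<in>K. \<psi> (c * (t + s)))"
    by (rule sum.reindex_bij_witness[of _ "\<lambda>t. t + s" "\<lambda>t. t - s"]) (auto intro: K_intros s)
  also have "\<dots> = \<psi> (- Tr x) * (\<Sum>t\<in>K. \<psi> (c * t))"
    by (simp add: distrib_left s(2) psi_add sum_distrib_left mult.commute del: add_uminus_conv_diff)
  finally show ?thesis using x by simp
qed

subsection \<open>Quadratic Gauss sums over the subfield\<close>

text \<open>Carries 0, 1 and -1 from the field to the complex numbers; it is applied to powers that
  take just these values.\<close>

definition sg :: "'a \<Rightarrow> complex" where
  "sg x = (if x = 0 then 0 else if x = 1 then 1 else -1)"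

text \<open>The quadratic character, meaningful on \<open>K\<close> only: the exponent is $(q-1)/2$.\<close>

definition eta :: "'a \<Rightarrow> complex" where "eta x = sg (x ^ (4 * m + 1))"

lemma K_pow_half:
  assumes "x \<in> K" "x \<noteq> 0"
  shows "x ^ (4 * m + 1) = 1 \<or> x ^ (4 * m + 1) = -1"
proof -
  have "x * (x ^ (4 * m + 1)) ^ 2 = x ^ q"
    by (simp add: q_mod numeral_3_eq_3 flip: power_mult power_Suc)
  hence "(x ^ (4 * m + 1)) ^ 2 = 1" using assms by (simp add: K_def)
  thus ?thesis by (rule power2_eq_1_iff[THEN iffD1])
qed

lemma eta_0 [simp]: "eta 0 = 0" by (simp add: eta_def sg_def)
lemma eta_1 [simp]: "eta 1 = 1" by (simp add: eta_def sg_def)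

lemma eta_mult:
  assumes "x \<in> K" "y \<in> K"
  shows "eta (x * y) = eta x * eta y"
proof (cases "x = 0 \<or> y = 0")
  case False
  thus ?thesis using K_pow_half[of x] K_pow_half[of y] assms one_neq_minus_one
    unfolding eta_def power_mult_distrib by (auto simp: sg_def)
qed auto

text \<open>The exponent (q-1)/2 = 4m + 1 is odd, so -1 is a nonsquare in \<open>K\<close>.\<close>

lemma eta_minus:
  assumes "x \<in> K"
  shows "eta (- x) = - eta x"
proof (cases "x = 0")
  case False
  thus ?thesis using K_pow_half[of x] assms one_neq_minus_one
    by (auto simp: eta_def sg_def)
qed auto

lemma eta_cases:
  assumes "x \<in> K" "x \<noteq> 0"
  obtains "eta x = 1" | "eta x = -1"
proof -
  have "eta x = 1 \<or> eta x = -1"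
    using K_pow_half[OF assms] one_neq_minus_one by (auto simp: eta_def sg_def simp del: power_Suc)
  thus ?thesis using that by blast
qed

lemma eta_sq: "x \<in> K \<Longrightarrow> x \<noteq> 0 \<Longrightarrow> eta x * eta x = 1"
  by (rule eta_cases) auto

lemma eta_inverse: "x \<in> K \<Longrightarrow> eta (1 / x) = eta x"
  using eta_sq[of x] eta_mult[of x "1 / x"] K_intros(1,2) K_divide[of 1 x]
  by (cases "x = 0") (auto, metis mult.right_neutral mult.assoc mult.left_commute)

lemma eta_divide: "x \<in> K \<Longrightarrow> y \<in> K \<Longrightarrow> eta (x / y) = eta x * eta y"
  using eta_mult[of x "1 / y"] eta_inverse[of y] K_divide[of 1 y] K_1 by simp

lemma eta_1_imp_square:
  assumes "x \<in> K" "eta x = 1"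
  obtains t where "t \<in> K" "t \<noteq> 0" "t ^ 2 = x"
proof
  txt \<open>As $q \equiv 3 \pmod 4$, the power $x^{(q+1)/4}$ is an explicit square root.\<close>
  have "(x ^ (2 * m + 1)) ^ 2 = x ^ (4 * m + 1) * x"
    by (simp add: power_mult_distrib power2_eq_square flip: power_add)
  moreover have "x ^ (4 * m + 1) = 1" using assms(2) by (auto simp: eta_def sg_def split: if_splits)
  ultimately show "(x ^ (2 * m + 1)) ^ 2 = x" by (simp only: mult_1)
  show "x ^ (2 * m + 1) \<in> K" by (rule K_power) fact
  show "x ^ (2 * m + 1) \<noteq> 0" using assms by auto
qed

lemma card_sqrt_K:
  assumes "s \<in> K"
  shows "of_nat (card {t \<in> K. t ^ 2 = s}) = 1 + eta s"
proof (cases "s = 0")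
  case True
  hence "{t \<in> K. t ^ 2 = s} = {0}" using K_0 by auto
  thus ?thesis using True by simp
next
  case False
  show ?thesis
  proof (rule eta_cases[OF assms False])
    assume *: "eta s = 1"
    then obtain t where t: "t \<in> K" "t \<noteq> 0" "t ^ 2 = s" using eta_1_imp_square assms by blast
    have "{r \<in> K. r ^ 2 = s} = {t, - t}"
      using t by (auto simp: power2_eq_iff K_minus)
    moreover have "t \<noteq> - t"
    proof
      assume "t = - t"
      hence "2 * t = 0" by (metis add.right_inverse mult_2)
      thus False using t by (simp add: two_eq)
    qed
    ultimately show ?thesis using * by simp
  next
    assume *: "eta s = -1"
    have "t ^ 2 \<noteq> s" if "t \<in> K" for t
    proof
      assume "t ^ 2 = s"
      hence "eta s = eta t * eta t" using eta_mult[of t t] that by (simp add: power2_eq_square)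
      moreover have "t \<noteq> 0" using \<open>t ^ 2 = s\<close> False by auto
      ultimately show False using * eta_sq[of t] that by simp
    qed
    hence "{t \<in> K. t ^ 2 = s} = {}" by auto
    thus ?thesis using * by simp
  qed
qed

text \<open>Groups t by its square, a fibre having 1 + \<open>eta\<close> s elements. Read backwards
  it removes a quadratic character from a sum.\<close>

lemma sum_squares:
  "(\<Sum>t\<in>K. h (t ^ 2)) = (\<Sum>s\<in>K. (1 + eta s) * h s)"
proof -
  have "(\<Sum>t\<in>K. h (t ^ 2)) = (\<Sum>s\<in>K. \<Sum>t\<in>{t \<in> K. t ^ 2 = s}. h (t ^ 2))"
    by (rule sum.group[symmetric]) (auto intro: K_power)
  also have "\<dots> = (\<Sum>s\<in>K. of_nat (card {t \<in> K. t ^ 2 = s}) * h s)"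
    by (intro sum.cong refl) simp
  finally show ?thesis by (simp add: card_sqrt_K)
qed

definition gauss :: "'a \<Rightarrow> complex" where "gauss A = (\<Sum>t\<in>K. \<psi> (A * t ^ 2))"

lemma gauss_eta:
  assumes "A \<in> K" "A \<noteq> 0"
  shows "gauss A = (\<Sum>s\<in>K. eta s * \<psi> (A * s))"
  using sum_squares[of "\<lambda>s. \<psi> (A * s)"] psi_sum_K[OF assms]
  by (simp add: gauss_def distrib_right sum.distrib)

lemma gauss_mult:
  assumes A: "A \<in> K" "A \<noteq> 0" and r: "r \<in> K" "r \<noteq> 0"
  shows "gauss (A * r) = eta r * gauss A"
proof -
  have "gauss (A * r) = (\<Sum>s\<in>K. eta s * \<psi> (A * (r * s)))"
    using gauss_eta[of "A * r"] assms by (simp add: K_mult mult.assoc)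
  also have "\<dots> = (\<Sum>s\<in>K. eta (s / r) * \<psi> (A * s))"
    by (rule sum.reindex_bij_witness[of _ "\<lambda>s. s / r" "\<lambda>s. r * s"])
       (use r in \<open>auto intro: K_intros\<close>)
  also have "\<dots> = eta r * gauss A"
    using assms by (simp add: gauss_eta sum_distrib_left eta_divide mult_ac)
  finally show ?thesis .
qed

lemma cnj_gauss: "cnj (gauss A) = gauss (- A)"
  by (simp add: gauss_def flip: psi_minus)

lemma gauss_minus: "A \<in> K \<Longrightarrow> A \<noteq> 0 \<Longrightarrow> gauss (- A) = - gauss A"
  using gauss_mult[of A "-1"] eta_minus[of 1] by (simp add: K_1 K_minus)

text \<open>With s = t + r, orthogonality in t leaves only r = 0 in the product of the Gauss sum
  with its conjugate, giving q. The conjugate is minus the sum itself because -1 is a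
  nonsquare.\<close>

lemma gauss_sq:
  assumes "A \<in> K" "A \<noteq> 0"
  shows "gauss A ^ 2 = - of_nat q"
proof -
  have *: "A * (t + r) ^ 2 - A * t ^ 2 = A * r ^ 2 + (- A * r) * t" for r t
    by (rule char3[where X = "A * r * t"]) (simp add: algebra_simps power2_eq_square)
  have "gauss A * cnj (gauss A) = (\<Sum>s\<in>K. \<Sum>t\<in>K. \<psi> (A * s ^ 2 - A * t ^ 2))"
    by (simp add: gauss_def sum_product psi_diff)
  also have "\<dots> = (\<Sum>t\<in>K. \<Sum>s\<in>K. \<psi> (A * s ^ 2 - A * t ^ 2))"
    by (rule sum.swap)
  also have "\<dots> = (\<Sum>t\<in>K. \<Sum>r\<in>K. \<psi> (A * (t + r) ^ 2 - A * t ^ 2))"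
  proof (rule sum.cong[OF refl])
    fix t assume "t \<in> K"
    thus "(\<Sum>s\<in>K. \<psi> (A * s ^ 2 - A * t ^ 2)) = (\<Sum>r\<in>K. \<psi> (A * (t + r) ^ 2 - A * t ^ 2))"
      by (intro sum.reindex_bij_witness[of _ "\<lambda>r. t + r" "\<lambda>s. s - t"]) (auto intro: K_intros)
  qed
  also have "\<dots> = (\<Sum>t\<in>K. \<Sum>r\<in>K. \<psi> (A * r ^ 2) * \<psi> ((- A * r) * t))"
    by (simp only: * psi_add)
  also have "\<dots> = (\<Sum>r\<in>K. \<psi> (A * r ^ 2) * (\<Sum>t\<in>K. \<psi> ((- A * r) * t)))"
    by (subst sum.swap) (simp only: sum_distrib_left)
  also have "\<dots> = (\<Sum>r\<in>K. if r = 0 then of_nat q else 0)"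
    using assms psi_sum_K[of "- A * r" for r] by (intro sum.cong refl) (auto simp: psi_zero card_K K_intros)
  also have "\<dots> = of_nat q" using K_0 by simp
  finally show ?thesis
    using assms by (simp add: cnj_gauss gauss_minus power2_eq_square) (metis minus_minus)
qed

text \<open>Completing the square, with 1/2 = -1 and 1/4 = 1 in characteristic three.\<close>

lemma gauss_linear:
  assumes "A \<in> K" "A \<noteq> 0" "B \<in> K"
  shows "(\<Sum>t\<in>K. \<psi> (A * t ^ 2 + B * t)) = gauss A * \<psi> (- (B ^ 2 / A))"
proof -
  have *: "A * t ^ 2 + B * t = A * (t - B / A) ^ 2 - B ^ 2 / A" for t
    by (rule char3[where X = "B * t"]) (use assms in \<open>simp add: field_simps power2_eq_square\<close>)
  have "(\<Sum>t\<in>K. \<psi> (A * t ^ 2 + B * t)) = (\<Sum>t\<in>K. \<psi> (A * (t - B / A) ^ 2)) * \<psi> (- (B ^ 2 / A))"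
    by (simp only: * psi_diff psi_minus sum_distrib_right)
  also have "(\<Sum>t\<in>K. \<psi> (A * (t - B / A) ^ 2)) = gauss A"
    unfolding gauss_def
    by (rule sum.reindex_bij_witness[of _ "\<lambda>t. t + B / A" "\<lambda>t. t - B / A"])
       (use assms in \<open>auto intro: K_intros\<close>)
  finally show ?thesis .
qed

text \<open>Translation by b^q / A completes the Hermitian square. In coordinates the norm is x^2 +
  y^2, so what remains is the square of a Gauss sum.\<close>

lemma norm_form_sum:
  assumes A: "A \<in> K" "A \<noteq> 0"
  shows "(\<Sum>x\<in>UNIV. \<psi> (- A * Nm x + Tr (b * x))) = - of_nat q * \<psi> (Nm b / A)"
proof -
  define y where "y = b ^ q / A"
  have Aq: "A ^ q = A" using A by (simp add: K_def)
  have y: "A * y = b ^ q" "A * y ^ q = b"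
    using A by (simp_all add: y_def power_divide frob_frob Aq)
  have *: "- A * Nm (x + y) + Tr (b * (x + y)) = - A * Nm x + Nm b / A" for x
  proof -
    have "Nm b / A = A * y * y ^ q"
      using A by (simp add: y Nm_def) (simp add: y_def power_divide frob_frob Aq field_simps)
    moreover have "Tr (b * (x + y)) = A * y ^ q * (x + y) + A * y * (x ^ q + y ^ q)"
      by (simp add: Tr_def power_mult_distrib frob_add y)
    ultimately show ?thesis by (simp add: Nm_def frob_add algebra_simps)
  qed
  have "(\<Sum>x\<in>UNIV. \<psi> (- A * Nm x + Tr (b * x)))
      = (\<Sum>x\<in>UNIV. \<psi> (- A * Nm (x + y) + Tr (b * (x + y))))"
    by (rule sum.reindex_bij_witness[of _ "\<lambda>x. x + y" "\<lambda>x. x - y"]) auto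
  also have "\<dots> = (\<Sum>x\<in>UNIV. \<psi> (- A * Nm x)) * \<psi> (Nm b / A)"
    by (simp only: * psi_add sum_distrib_right)
  also have "(\<Sum>x\<in>UNIV. \<psi> (- A * Nm x)) = (\<Sum>x\<in>K. \<Sum>y\<in>K. \<psi> (- A * x ^ 2) * \<psi> (- A * y ^ 2))"
    unfolding sum_coords
    by (intro sum.cong refl) (simp add: Nm_coords distrib_left flip: psi_add)
  also have "\<dots> = gauss (- A) ^ 2"
    by (simp add: gauss_def power2_eq_square sum_product)
  also have "\<dots> = - of_nat q"
    using gauss_sq[of "- A"] A by (simp add: K_minus)
  finally show ?thesis .
qed

subsection \<open>The quartic character and the twisted sum\<close>

lemma i_distinct [simp]:
  "\<iota> \<noteq> 1" "\<iota> \<noteq> -1" "\<iota> \<noteq> - \<iota>" "- \<iota> \<noteq> \<iota>" "- \<iota> \<noteq> 1" "- \<iota> \<noteq> -1" "1 \<noteq> \<iota>" "-1 \<noteq> \<iota>"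
  "(1::'a) \<noteq> -1" "(-1::'a) \<noteq> 1" "1 \<noteq> - \<iota>" "\<iota> \<noteq> 0"
proof -
  show *: "(1::'a) \<noteq> -1" "(-1::'a) \<noteq> 1" using one_neq_minus_one by auto
  show **: "\<iota> \<noteq> 1" "\<iota> \<noteq> -1" "\<iota> \<noteq> 0" using i_sq * by auto
  show "- \<iota> \<noteq> 1" "- \<iota> \<noteq> -1" "1 \<noteq> \<iota>" "-1 \<noteq> \<iota>" "1 \<noteq> - \<iota>" using ** by (auto simp: minus_equation_iff)
  have "\<iota> \<noteq> - \<iota>"
  proof
    assume "\<iota> = - \<iota>"
    hence "2 * \<iota> = 0" by (metis add.right_inverse mult_2)
    thus False using i_nz by (simp add: two_eq)
  qed
  thus "\<iota> \<noteq> - \<iota>" "- \<iota> \<noteq> \<iota>" by metis+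
qed

lemma i_mult [simp]: "\<iota> * \<iota> = -1" "1 / \<iota> = - \<iota>"
  using i_sq i_nz by (auto simp: power2_eq_square field_simps)

lemma i_frob_mult: "(\<iota> * z) ^ q = - \<iota> * z ^ q"
  by (simp add: power_mult_distrib i_frob)

lemma Nm_i [simp]: "Nm \<iota> = 1"
  by (simp add: Nm_def i_frob)

text \<open>The exponent is $(q^2-1)/4$.\<close>

definition chi :: "'a \<Rightarrow> 'a" where "chi x = x ^ (2 * (2 * m + 1) * (4 * m + 1))"

lemma chi_mult: "chi (x * y) = chi x * chi y"
  by (simp only: chi_def power_mult_distrib)

lemma chi_0 [simp]: "chi 0 = 0" by (simp add: chi_def)

text \<open>Twice the exponent of \<open>chi\<close> is (q+1)(q-1)/2: the square of the quartic
  character is the quadratic character of the norm.\<close>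

lemma chi_sq: "chi x ^ 2 = Nm x ^ (4 * m + 1)"
proof -
  have Nm: "Nm x = x ^ (q + 1)" by (simp add: Nm_def)
  have "2 * (2 * m + 1) * (4 * m + 1) * 2 = (q + 1) * (4 * m + 1)"
    by (simp add: q_mod algebra_simps)
  thus ?thesis unfolding chi_def Nm power_mult[symmetric] by (rule arg_cong)
qed

lemma chi_cases:
  assumes "x \<noteq> 0"
  obtains "chi x = 1" | "chi x = \<iota>" | "chi x = -1" | "chi x = - \<iota>"
proof -
  have "chi x ^ 2 = 1 \<or> chi x ^ 2 = \<iota> ^ 2"
    using K_pow_half[OF K_Nm, of x] assms unfolding chi_sq i_sq by simp
  thus ?thesis using that by (auto simp: power2_eq_1_iff power2_eq_iff)
qed

text \<open>The exponent is (q-1) times the integer (q+1)/4, so the character is constant on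
  punctured lines through the origin.\<close>

lemma chi_K:
  assumes "t \<in> K" "t \<noteq> 0"
  shows "chi t = 1"
proof -
  have "chi t = (t ^ (4 * m + 1)) ^ (2 * (2 * m + 1))"
    unfolding chi_def by (simp only: mult.commute power_mult)
  thus ?thesis using K_pow_half[OF assms] by (auto simp del: power_Suc simp: power_mult)
qed

text \<open>As q is 3 modulo 4, Frobenius exchanges the classes \<iota> and -\<iota> and fixes 1 and
  -1.\<close>

lemma chi_frob:
  assumes "x \<noteq> 0"
  shows "chi (x ^ q) = chi x ^ 3"
proof -
  have "chi (x ^ q) = chi x ^ q" unfolding chi_def power_mult[symmetric] by (simp only: mult.commute)
  also have "\<dots> = (chi x ^ 4) ^ (2 * m) * chi x ^ 3"
    by (simp add: q_mod power_add flip: power_mult)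
  also have "chi x ^ 4 = 1"
  proof -
    have "(chi x ^ 2) ^ 2 = 1"
      by (rule chi_cases[OF assms]) (auto simp: power2_eq_square)
    thus ?thesis using power_mult[of "chi x" 2 2] by simp
  qed
  finally show ?thesis by simp
qed

lemma chi_i: "chi \<iota> = -1"
proof -
  have "chi \<iota> = (\<iota> ^ 2) ^ ((2 * m + 1) * (4 * m + 1))"
    unfolding chi_def by (simp only: power_mult mult.assoc)
  thus ?thesis by (simp add: i_sq)
qed

lemma eta_Nm: "eta (Nm x) = sg (chi x ^ 2)"
  by (simp only: eta_def chi_sq)

text \<open>\<open>eps\<close> is the sign in f. Its product with the quadratic character of the
  norm is \<open>sigma\<close> of the quartic character, and \<open>rho\<close> is the mean of
  \<open>sigma\<close> over y and y^3, that is, over Frobenius.\<close>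

definition eps :: "'a \<Rightarrow> complex" where
  "eps x = (if chi x = 1 \<or> chi x = \<iota> then 1 else -1)"
definition sigma :: "'a \<Rightarrow> complex" where
  "sigma y = (if y = 1 \<or> y = - \<iota> then 1 else -1)"
definition rho :: "'a \<Rightarrow> complex" where
  "rho y = (if y = 1 then 1 else if y = -1 then -1 else 0)"

lemma eps_eta:
  assumes "x \<noteq> 0"
  shows "eps x * eta (Nm x) = sigma (chi x)"
  by (rule chi_cases[OF assms]) (simp_all add: eps_def eta_Nm sigma_def sg_def power2_eq_square)

section \<open>Averaging the twisted sum over lines through the origin\<close>

lemma sum_scale:
  fixes b :: 'a and h :: "'a \<Rightarrow> complex"
  assumes "b \<noteq> 0"
  shows "(\<Sum>x\<in>UNIV - {0}. h (b * x)) = (\<Sum>x\<in>UNIV - {0}. h x)"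
  by (rule sum.reindex_bij_witness[of _ "\<lambda>x. x / b" "\<lambda>x. b * x"]) (use assms in auto)

lemma sum_average_K:
  fixes h :: "'a \<Rightarrow> complex"
  shows "(of_nat q - 1) * (\<Sum>x\<in>UNIV - {0}. h x) = (\<Sum>x\<in>UNIV - {0}. \<Sum>t\<in>K - {0}. h (t * x))"
proof -
  have "(\<Sum>x\<in>UNIV - {0}. \<Sum>t\<in>K - {0}. h (t * x)) = (\<Sum>t\<in>K - {0}. \<Sum>x\<in>UNIV - {0}. h (t * x))"
    by (rule sum.swap)
  also have "\<dots> = (\<Sum>t\<in>K - {0}. \<Sum>x\<in>UNIV - {0}. h x)"
    by (intro sum.cong refl sum_scale) auto
  also have "\<dots> = (of_nat q - 1) * (\<Sum>x\<in>UNIV - {0}. h x)"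
    using K_0 odd_pos[OF odd_q] by (simp add: card_K of_nat_diff)
  finally show ?thesis ..
qed

text \<open>Twice the part of the Walsh sum that is odd in the sign \<open>eps\<close>.\<close>

definition twist :: "'a \<Rightarrow> 'a \<Rightarrow> complex" where
  "twist c b = (\<Sum>x\<in>UNIV. eps x * (\<psi> (- c * Nm x) - \<psi> (c * Nm x)) * \<psi> (Tr (b * x)))"

lemma Tr_0 [simp]: "Tr 0 = 0" and Nm_0: "Nm 0 = 0"
  using odd_q by (auto simp: Tr_def power_0_left intro: Nat.gr0I)

text \<open>Multiplication by \<iota> preserves the norm but flips \<open>eps\<close>, since
  \<open>chi\<close> \<iota> = -1; the sum equals its own negative.\<close>

lemma twist_0: "twist c 0 = 0"
proof -
  let ?h = "\<lambda>x. eps x * (\<psi> (- c * Nm x) - \<psi> (c * Nm x))"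
  have "twist c 0 = (\<Sum>x\<in>UNIV - {0}. ?h x)"
    unfolding twist_def by (intro sum.mono_neutral_cong_right) (auto simp: psi_zero Nm_0)
  moreover have "(\<Sum>x\<in>UNIV - {0}. ?h x) = (\<Sum>x\<in>UNIV - {0}. ?h (\<iota> * x))"
    by (rule sum_scale[symmetric]) (rule i_nz)
  moreover have "\<dots> = (\<Sum>x\<in>UNIV - {0}. - ?h x)"
  proof (rule sum.cong[OF refl])
    fix x :: 'a assume "x \<in> UNIV - {0}"
    hence "x \<noteq> 0" by simp
    hence "eps (\<iota> * x) = - eps x"
      by (rule chi_cases) (auto simp: eps_def chi_mult chi_i)
    thus "?h (\<iota> * x) = - ?h x" by (simp add: Nm_mult)
  qed
  ultimately have "twist c 0 = - twist c 0" by (simp add: sum_negf)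
  thus ?thesis by simp
qed

text \<open>On the line through x, \<open>eps\<close> is constant while norm and trace scale by t^2
  and t. The sum over t is a Gauss sum with linear term, whose factor \<open>eta\<close>
  (\<open>Nm\<close> x) turns \<open>eps\<close> into \<open>sigma\<close>.\<close>

lemma twist_lines:
  assumes c: "c \<in> K" "c \<noteq> 0"
  shows "(of_nat q - 1) * twist c b = - gauss c * (\<Sum>x\<in>UNIV - {0}. sigma (chi x) *
           (\<psi> (Tr (b * x) ^ 2 / (c * Nm x)) + \<psi> (- (Tr (b * x) ^ 2 / (c * Nm x)))))"
proof -
  let ?h = "\<lambda>x. eps x * (\<psi> (- c * Nm x) - \<psi> (c * Nm x)) * \<psi> (Tr (b * x))"
  have "twist c b = (\<Sum>x\<in>UNIV - {0}. ?h x)"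
    unfolding twist_def by (intro sum.mono_neutral_cong_right) (auto simp: psi_zero Nm_0)
  hence "(of_nat q - 1) * twist c b = (\<Sum>x\<in>UNIV - {0}. \<Sum>t\<in>K - {0}. ?h (t * x))"
    by (simp only: sum_average_K)
  also have "\<dots> = (\<Sum>x\<in>UNIV - {0}. - gauss c * (sigma (chi x) *
           (\<psi> (Tr (b * x) ^ 2 / (c * Nm x)) + \<psi> (- (Tr (b * x) ^ 2 / (c * Nm x))))))"
  proof (rule sum.cong[OF refl])
    fix x :: 'a assume "x \<in> UNIV - {0}"
    hence x: "x \<noteq> 0" by simp
    define A where "A = c * Nm x"
    define B where "B = Tr (b * x)"
    have A: "A \<in> K" "A \<noteq> 0" using c x by (auto simp: A_def intro: K_intros)
    have B: "B \<in> K" by (simp add: B_def K_Tr)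
    have "(\<Sum>t\<in>K - {0}. ?h (t * x))
        = (\<Sum>t\<in>K - {0}. eps x * (\<psi> (- A * t ^ 2 + B * t) - \<psi> (A * t ^ 2 + B * t)))"
    proof (rule sum.cong[OF refl])
      fix t assume t: "t \<in> K - {0}"
      have "eps (t * x) = eps x" using t by (simp add: eps_def chi_mult chi_K)
      moreover have "Nm (t * x) = t ^ 2 * Nm x" using t by (simp add: Nm_mult Nm_K)
      moreover have "Tr (b * (t * x)) = B * t"
        using t Tr_mult_K[of t "b * x"] by (simp add: B_def mult_ac)
      ultimately show "?h (t * x) = eps x * (\<psi> (- A * t ^ 2 + B * t) - \<psi> (A * t ^ 2 + B * t))"
        by (simp only: psi_add) (simp add: A_def algebra_simps)
    qed
    also have "\<dots> = (\<Sum>t\<in>K. eps x * (\<psi> (- A * t ^ 2 + B * t) - \<psi> (A * t ^ 2 + B * t)))"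
      by (rule sum.mono_neutral_left) auto
    also have "\<dots> = eps x * ((\<Sum>t\<in>K. \<psi> (- A * t ^ 2 + B * t)) - (\<Sum>t\<in>K. \<psi> (A * t ^ 2 + B * t)))"
      by (simp only: sum_distrib_left[symmetric] sum_subtractf)
    \<comment> \<open>The difference becomes a sum because the Gauss sum is odd in
      \<open>A\<close>.\<close>
    also have "\<dots> = - (eps x * gauss A) * (\<psi> (B ^ 2 / A) + \<psi> (- (B ^ 2 / A)))"
      using gauss_linear[OF A B] gauss_linear[of "- A" B] A B
      by (simp add: K_minus gauss_minus algebra_simps)
    also have "gauss A = eta (Nm x) * gauss c"
      using c x by (simp add: A_def gauss_mult K_Nm)
    finally show "(\<Sum>t\<in>K - {0}. ?h (t * x)) = - gauss c * (sigma (chi x) *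
           (\<psi> (Tr (b * x) ^ 2 / (c * Nm x)) + \<psi> (- (Tr (b * x) ^ 2 / (c * Nm x)))))"
      using x by (simp add: A_def B_def flip: eps_eta)
  qed
  finally show ?thesis by (simp only: sum_distrib_left)
qed

text \<open>With w = z^(q-1) this is w + 2 + 1/w for nonzero z: an invariant of the line through z
  and of Frobenius.\<close>

definition tn_ratio :: "'a \<Rightarrow> 'a" where "tn_ratio z = Tr z ^ 2 / Nm z"

definition rho_sum :: "'a \<Rightarrow> complex" where
  "rho_sum D = (\<Sum>z\<in>UNIV - {0}. rho (chi z) * \<psi> (D * tn_ratio z))"

lemma sum_frob: "(\<Sum>z\<in>UNIV - {0}. h (z ^ q)) = (\<Sum>z\<in>UNIV - {0}. h z)" for h :: "'a \<Rightarrow> complex"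
  by (rule sum.reindex_bij_witness[of _ "\<lambda>z. z ^ q" "\<lambda>z. z ^ q"]) (auto simp: frob_frob)

lemma tn_ratio_frob: "tn_ratio (z ^ q) = tn_ratio z"
  by (simp add: tn_ratio_def Tr_def Nm_def frob_frob add.commute mult.commute)

lemma cnj_rho: "cnj (rho y) = rho y" by (simp add: rho_def)

lemma rho_sum_minus: "rho_sum (- D) = cnj (rho_sum D)"
  by (simp add: rho_sum_def cnj_rho flip: psi_minus)

text \<open>The substitution z = bx absorbs b into D and a shift of the quartic class. Averaging
  with the Frobenius image then replaces \<open>sigma\<close> by \<open>rho\<close>, up to a sign
  depending on b.\<close>

lemma twist_eq_rho_sum:
  assumes c: "c \<in> K" "c \<noteq> 0" and b: "b \<noteq> 0"
  shows "(of_nat q - 1) * twist c b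
       = - gauss c * sigma (1 / chi b) * (rho_sum (Nm b / c) + cnj (rho_sum (Nm b / c)))"
proof -
  define D where "D = Nm b / c"
  define kk where "kk z = \<psi> (D * tn_ratio z) + \<psi> (- D * tn_ratio z)" for z
  define \<beta> where "\<beta> = chi b"
  define T where "T = (\<Sum>z\<in>UNIV - {0}. sigma (chi z / \<beta>) * kk z)"
  have "\<beta> \<noteq> 0" using b by (simp add: \<beta>_def chi_def)
  have "(\<Sum>x\<in>UNIV - {0}. sigma (chi x) *
           (\<psi> (Tr (b * x) ^ 2 / (c * Nm x)) + \<psi> (- (Tr (b * x) ^ 2 / (c * Nm x)))))
      = (\<Sum>x\<in>UNIV - {0}. sigma (chi (b * x) / \<beta>) * kk (b * x))"
  proof (rule sum.cong[OF refl])
    fix x :: 'a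
    have "D * tn_ratio (b * x) = Tr (b * x) ^ 2 / (c * Nm x)"
      using b by (simp add: D_def tn_ratio_def Nm_mult)
    thus "sigma (chi x) * (\<psi> (Tr (b * x) ^ 2 / (c * Nm x)) + \<psi> (- (Tr (b * x) ^ 2 / (c * Nm x))))
        = sigma (chi (b * x) / \<beta>) * kk (b * x)"
      using \<open>\<beta> \<noteq> 0\<close> by (simp add: kk_def chi_mult flip: \<beta>_def)
  qed
  also have "\<dots> = T" unfolding T_def by (rule sum_scale) fact
  finally have 1: "(of_nat q - 1) * twist c b = - gauss c * T"
    using twist_lines[OF c] by simp
  have "2 * T = (\<Sum>z\<in>UNIV - {0}. sigma (chi z / \<beta>) * kk z)
        + (\<Sum>z\<in>UNIV - {0}. sigma (chi (z ^ q) / \<beta>) * kk (z ^ q))"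
    by (simp only: sum_frob[of "\<lambda>z. sigma (chi z / \<beta>) * kk z"] T_def mult_2)
  also have "\<dots> = (\<Sum>z\<in>UNIV - {0}. 2 * (sigma (1 / \<beta>) * (rho (chi z) * kk z)))"
    unfolding sum.distrib[symmetric]
  proof (rule sum.cong[OF refl])
    fix z :: 'a assume "z \<in> UNIV - {0}"
    hence z: "z \<noteq> 0" by simp
    have kk: "kk (z ^ q) = kk z" by (simp add: kk_def tn_ratio_frob)
    \<comment> \<open>\<open>sigma\<close> is odd on the fourth roots of unity, and cubing negates
      \<iota> and -\<iota> but fixes 1 and -1.\<close>
    have "sigma (chi z / \<beta>) + sigma (chi z ^ 3 / \<beta>) = 2 * sigma (1 / \<beta>) * rho (chi z)"
      using z b unfolding \<beta>_def
      by (rule_tac chi_cases[of z]; rule_tac chi_cases[of b])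
         (auto simp: sigma_def rho_def power3_eq_cube)
    hence "(sigma (chi z / \<beta>) + sigma (chi z ^ 3 / \<beta>)) * kk z = 2 * sigma (1 / \<beta>) * rho (chi z) * kk z"
      by (rule arg_cong)
    thus "sigma (chi z / \<beta>) * kk z + sigma (chi (z ^ q) / \<beta>) * kk (z ^ q)
        = 2 * (sigma (1 / \<beta>) * (rho (chi z) * kk z))"
      by (simp only: kk chi_frob[OF z] distrib_right mult.assoc)
  qed
  also have "\<dots> = 2 * (sigma (1 / \<beta>) * (rho_sum D + rho_sum (- D)))"
    by (simp only: rho_sum_def kk_def sum_distrib_left[symmetric] sum.distrib[symmetric] distrib_left[symmetric])
  finally have "T = sigma (1 / \<beta>) * (rho_sum D + rho_sum (- D))" by simp
  thus ?thesis using 1 by (simp add: rho_sum_minus D_def \<beta>_def)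
qed

text \<open>Since Tr(\<iota>z) = \<iota>(z - z^q), its square is 4 N(z) - Tr(z)^2, and 4 =
  1.\<close>

lemma tn_ratio_i:
  assumes "z \<noteq> 0"
  shows "tn_ratio (\<iota> * z) = 1 - tn_ratio z"
proof -
  have "Tr (\<iota> * z) ^ 2 = \<iota> ^ 2 * (z - z ^ q) ^ 2"
    unfolding Tr_def i_frob_mult by (simp only: power_mult_distrib[symmetric]) (simp add: algebra_simps)
  also have "\<dots> = Nm z - Tr z ^ 2"
    unfolding i_sq by (rule char3[where X = "Nm z"]) (simp add: Nm_def Tr_def algebra_simps power2_eq_square)
  finally show ?thesis using assms by (simp add: tn_ratio_def Nm_mult diff_divide_distrib)
qed

text \<open>The substitution z -> \<iota>z negates \<open>rho\<close> and reflects
  \<open>tn_ratio\<close> about 1. This constrains the complex argument of the sum.\<close>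

lemma rho_sum_reflect: "rho_sum D = - \<psi> D * cnj (rho_sum D)"
proof -
  have "rho_sum D = (\<Sum>z\<in>UNIV - {0}. rho (chi (\<iota> * z)) * \<psi> (D * tn_ratio (\<iota> * z)))"
    unfolding rho_sum_def by (rule sum_scale[symmetric, OF i_nz])
  also have "\<dots> = (\<Sum>z\<in>UNIV - {0}. - \<psi> D * cnj (rho (chi z) * \<psi> (D * tn_ratio z)))"
  proof (rule sum.cong[OF refl])
    fix z :: 'a assume "z \<in> UNIV - {0}"
    hence z: "z \<noteq> 0" by simp
    have "rho (chi (\<iota> * z)) = - rho (chi z)"
      by (rule chi_cases[OF z]) (auto simp: rho_def chi_mult chi_i)
    moreover have "\<psi> (D * tn_ratio (\<iota> * z)) = \<psi> D * cnj (\<psi> (D * tn_ratio z))"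
      by (simp add: tn_ratio_i[OF z] right_diff_distrib psi_diff)
    ultimately show "rho (chi (\<iota> * z)) * \<psi> (D * tn_ratio (\<iota> * z)) = - \<psi> D * cnj (rho (chi z) * \<psi> (D * tn_ratio z))"
      by (simp add: cnj_rho)
  qed
  also have "\<dots> = - \<psi> D * cnj (rho_sum D)" by (simp only: rho_sum_def cnj_sum sum_distrib_left)
  finally show ?thesis .
qed

subsection \<open>Evaluation of the twisted sum\<close>

text \<open>
  If $N(z) = t^2$ with $t \in K$, then $(z + t)^2 = z (\mathrm{Tr}\,z + 2t)$, and every element of $K$
  is a square in the extension.
\<close>

lemma square_if_chi_sq:
  assumes "z \<noteq> 0" "chi z ^ 2 = 1"
  obtains y where "y ^ 2 = z"
proof -
  have "eta (Nm z) = 1" using assms(2) by (simp add: eta_Nm sg_def)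
  then obtain s where s: "s \<in> K" "s \<noteq> 0" "s ^ 2 = Nm z" using eta_1_imp_square K_Nm by blast
  \<comment> \<open>If one root s gives Tr z + 2s = 0, the root -s gives -4s = -s, which is
    nonzero.\<close>
  have "\<exists>t\<in>K. t ^ 2 = Nm z \<and> Tr z + 2 * t \<noteq> 0"
  proof (cases "Tr z + 2 * s = 0")
    case True
    hence "Tr z + 2 * (- s) = - 4 * s" by (simp add: add_eq_0_iff2)
    also have "\<dots> = - s" by (rule char3[where X = "- s"]) simp
    finally show ?thesis using s by (intro bexI[of _ "- s"]) (auto simp: K_minus)
  qed (use s in auto)
  then obtain t where t: "t \<in> K" "t ^ 2 = Nm z" "Tr z + 2 * t \<noteq> 0" by blast
  define \<kappa> where "\<kappa> = Tr z + 2 * t"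
  have \<kappa>: "\<kappa> \<in> K" "\<kappa> \<noteq> 0"
    unfolding \<kappa>_def by (simp only: mult_2 K_add K_Tr t(1)) (rule t(3))
  have "(z + t) ^ 2 = z ^ 2 + 2 * z * t + t ^ 2" by (simp add: algebra_simps power2_eq_square)
  also have "\<dots> = z * \<kappa>" unfolding t(2) by (simp add: \<kappa>_def Nm_def Tr_def algebra_simps power2_eq_square)
  finally have zt: "z = (z + t) ^ 2 / \<kappa>" using \<kappa> by simp
  obtain r where "r ^ 2 = \<kappa>"
  proof (rule eta_cases[OF \<kappa>])
    assume "eta \<kappa> = 1"
    thus thesis using eta_1_imp_square[OF \<kappa>(1)] that by metis
  next
    assume "eta \<kappa> = -1"
    hence "eta (- \<kappa>) = 1" using \<kappa>(1) by (simp add: eta_minus)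
    then obtain r where "r ^ 2 = - \<kappa>" using eta_1_imp_square[OF K_minus[OF \<kappa>(1)]] by metis
    hence "(\<iota> * r) ^ 2 = \<kappa>" by (simp add: power_mult_distrib i_sq)
    thus thesis by (rule that)
  qed
  hence "((z + t) / r) ^ 2 = z" using zt by (simp add: power_divide)
  thus thesis by (rule that)
qed

lemma tn_ratio_sq:
  assumes "y \<noteq> 0"
  shows "tn_ratio (y ^ 2) = (tn_ratio y + 1) ^ 2"
proof -
  have "Tr (y ^ 2) = Tr y ^ 2 + Nm y"
    by (rule char3[where X = "- Nm y"])
       (simp add: Tr_def Nm_def power2_eq_square power_mult_distrib algebra_simps)
  moreover have "tn_ratio y + 1 = (Tr y ^ 2 + Nm y) / Nm y" using assms by (simp add: tn_ratio_def add_divide_distrib)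
  ultimately show ?thesis by (simp add: tn_ratio_def power2_eq_square Nm_mult)
qed

text \<open>\<open>rho\<close> keeps only the classes 1 and -1, which consist of squares with two
  roots each; on z = y^2 the class is the quadratic character of N(y).\<close>

lemma rho_sum_eq_sum_squares:
  "2 * rho_sum D = (\<Sum>y\<in>UNIV - {0}. eta (Nm y) * \<psi> (D * (tn_ratio y + 1) ^ 2))"
proof -
  let ?F = "\<lambda>z. rho (chi z) * \<psi> (D * tn_ratio z)"
  have "(\<Sum>y\<in>UNIV - {0}. eta (Nm y) * \<psi> (D * (tn_ratio y + 1) ^ 2)) = (\<Sum>y\<in>UNIV - {0}. ?F (y ^ 2))"
  proof (rule sum.cong[OF refl])
    fix y :: 'a assume "y \<in> UNIV - {0}"
    hence y: "y \<noteq> 0" by simp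
    have "chi (y ^ 2) = chi y ^ 2" by (simp add: power2_eq_square chi_mult)
    hence "rho (chi (y ^ 2)) = eta (Nm y)"
      by (simp only: eta_Nm) (rule chi_cases[OF y]; simp add: rho_def sg_def power2_eq_square)
    thus "eta (Nm y) * \<psi> (D * (tn_ratio y + 1) ^ 2) = ?F (y ^ 2)" using y by (simp add: tn_ratio_sq)
  qed
  also have "\<dots> = (\<Sum>z\<in>UNIV - {0}. \<Sum>y\<in>{y \<in> UNIV - {0}. y ^ 2 = z}. ?F (y ^ 2))"
    by (rule sum.group[symmetric]) auto
  also have "\<dots> = (\<Sum>z\<in>UNIV - {0}. 2 * ?F z)"
  proof (rule sum.cong[OF refl])
    fix z :: 'a assume "z \<in> UNIV - {0}"
    hence z: "z \<noteq> 0" by simp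
    have "(\<Sum>y\<in>{y \<in> UNIV - {0}. y ^ 2 = z}. ?F (y ^ 2)) = of_nat (card {y \<in> UNIV - {0}. y ^ 2 = z}) * ?F z"
      by simp
    also have "\<dots> = 2 * ?F z"
    proof (cases "rho (chi z) = 0")
      case False
      hence "chi z ^ 2 = 1" by (auto simp: rho_def split: if_splits)
      then obtain y where y: "y ^ 2 = z" using square_if_chi_sq z by blast
      hence "y \<noteq> 0" using z by auto
      have "{y \<in> UNIV - {0}. y ^ 2 = z} = {y, - y}"
        using y \<open>y \<noteq> 0\<close> by (auto simp: power2_eq_iff)
      moreover have "y \<noteq> - y"
      proof
        assume "y = - y"
        hence "2 * y = 0" by (metis add.right_inverse mult_2)
        thus False using \<open>y \<noteq> 0\<close> by (simp add: two_eq)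
      qed
      ultimately have "card {y \<in> UNIV - {0}. y ^ 2 = z} = 2" by simp
      thus ?thesis by simp
    qed simp
    finally show "(\<Sum>y\<in>{y \<in> UNIV - {0}. y ^ 2 = z}. ?F (y ^ 2)) = 2 * ?F z" .
  qed
  also have "\<dots> = 2 * rho_sum D" by (simp only: rho_sum_def sum_distrib_left)
  finally show ?thesis ..
qed

text \<open>The lines through the origin are represented by 1 and by r + \<iota> with r in
  \<open>K\<close>; each has q - 1 nonzero points.\<close>

lemma sum_projective_line:
  fixes F :: "'a \<Rightarrow> complex"
  assumes inv: "\<And>t x. t \<in> K \<Longrightarrow> t \<noteq> 0 \<Longrightarrow> F (t * x) = F x"
  shows "(\<Sum>y\<in>UNIV - {0}. F y) = (of_nat q - 1) * (F 1 + (\<Sum>r\<in>K. F (r + \<iota>)))"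
proof -
  define h where "h y = (if y = 0 then 0 else F y)" for y
  have cardK: "of_nat (card (K - {0})) = (of_nat q - 1 :: complex)"
    using K_0 odd_pos[OF odd_q] by (simp add: card_K of_nat_diff)
  have "(\<Sum>y\<in>UNIV - {0}. F y) = (\<Sum>y\<in>UNIV. h y)"
    by (rule sum.mono_neutral_cong_left) (auto simp: h_def)
  also have "\<dots> = (\<Sum>y\<in>K. \<Sum>x\<in>K. h (x + y * \<iota>))"
    unfolding sum_coords by (rule sum.swap)
  also have "\<dots> = (\<Sum>x\<in>K. h x) + (\<Sum>y\<in>K - {0}. \<Sum>x\<in>K. h (x + y * \<iota>))"
    using sum.remove[OF finite_K K_0, of "\<lambda>y. \<Sum>x\<in>K. h (x + y * \<iota>)"] by simp
  also have "(\<Sum>x\<in>K. h x) = (\<Sum>x\<in>K - {0}. F 1)"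
    using inv[of _ 1] by (intro sum.mono_neutral_cong_right) (auto simp: h_def)
  also have "(\<Sum>y\<in>K - {0}. \<Sum>x\<in>K. h (x + y * \<iota>)) = (\<Sum>y\<in>K - {0}. \<Sum>r\<in>K. F (r + \<iota>))"
  proof (rule sum.cong[OF refl])
    fix y assume y: "y \<in> K - {0}"
    have "(\<Sum>x\<in>K. h (x + y * \<iota>)) = (\<Sum>x\<in>K. F (y * (x / y + \<iota>)))"
      using y by (intro sum.cong refl) (auto simp: h_def coords_nz distrib_left)
    also have "\<dots> = (\<Sum>x\<in>K. F (x / y + \<iota>))"
      using y inv by (intro sum.cong refl) auto
    also have "\<dots> = (\<Sum>r\<in>K. F (r + \<iota>))"
      by (rule sum.reindex_bij_witness[of _ "\<lambda>r. r * y" "\<lambda>x. x / y"]) (use y in \<open>auto intro: K_intros\<close>)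
    finally show "(\<Sum>x\<in>K. h (x + y * \<iota>)) = (\<Sum>r\<in>K. F (r + \<iota>))" .
  qed
  finally show ?thesis by (simp only: sum_constant cardK distrib_left)
qed

text \<open>At r + \<iota> the norm is r^2 + 1 and the ratio r^2/(r^2 + 1). With p = r^2 and s =
  1/(p + 1) the ratio is 1 - s, and the weight (1 + \<open>eta\<close> p) \<open>eta\<close> (p + 1)
  becomes \<open>eta\<close> s + \<open>eta\<close> (1 - s).\<close>

lemma sum_eta_Nm_tn_ratio:
  fixes g :: "'a \<Rightarrow> complex"
  shows "(\<Sum>y\<in>UNIV - {0}. eta (Nm y) * g (tn_ratio y)) = (of_nat q - 1) * (\<Sum>s\<in>K. (eta s + eta (1 - s)) * g (1 - s))"
proof -
  let ?F = "\<lambda>y. eta (Nm y) * g (tn_ratio y)"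
  have inv: "?F (t * x) = ?F x" if t: "t \<in> K" "t \<noteq> 0" for t x
  proof -
    have "Nm (t * x) = (t * t) * Nm x" using t by (simp add: Nm_mult Nm_K power2_eq_square)
    moreover from this have "tn_ratio (t * x) = tn_ratio x"
      using t by (simp add: tn_ratio_def Tr_mult_K power2_eq_square)
    ultimately show ?thesis using t by (simp add: eta_mult eta_sq K_mult K_Nm)
  qed
  have F1: "?F 1 = g 1"
  proof -
    have "Tr 1 ^ 2 = 1" by (simp add: Tr_def two_eq)
    thus ?thesis by (simp add: tn_ratio_def Nm_def)
  qed
  have Fr: "?F (r + \<iota>) = eta (r ^ 2 + 1) * g (r ^ 2 / (r ^ 2 + 1))" if "r \<in> K" for r
    using Nm_coords[OF that K_1] Tr_coords[OF that K_1] by (simp add: tn_ratio_def)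
  let ?f = "\<lambda>p. (1 + eta p) * (eta (p + 1) * g (p / (p + 1)))"
  have "(\<Sum>r\<in>K. ?F (r + \<iota>)) = (\<Sum>p\<in>K. ?f p)"
    using sum_squares[of "\<lambda>p. eta (p + 1) * g (p / (p + 1))"] by (simp add: Fr)
  also have "\<dots> = (\<Sum>p\<in>K - {-1}. ?f p)"
    by (rule sum.mono_neutral_right) auto
  also have "\<dots> = (\<Sum>s\<in>K - {0}. (eta s + eta (1 - s)) * g (1 - s))"
  proof (rule sum.reindex_bij_witness[of _ "\<lambda>s. 1 / s - 1" "\<lambda>p. 1 / (p + 1)"])
    fix p assume p: "p \<in> K - {-1}"
    hence nz: "p + 1 \<noteq> 0" by (auto simp: add_eq_0_iff2)
    show "1 / (1 / (p + 1)) - 1 = p" by simp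
    show "1 / (p + 1) \<in> K - {0}" using p nz by (auto intro: K_intros)
    have 1: "1 - 1 / (p + 1) = p / (p + 1)" using nz by (simp add: field_simps)
    have pK: "p \<in> K" "p + 1 \<in> K" using p by (auto intro: K_intros)
    show "(eta (1 / (p + 1)) + eta (1 - 1 / (p + 1))) * g (1 - 1 / (p + 1)) = ?f p"
      unfolding 1 using pK by (simp add: eta_inverse eta_divide algebra_simps)
  next
    fix s assume s: "s \<in> K - {0}"
    thus "1 / (1 / s - 1 + 1) = s" by simp
    show "1 / s - 1 \<in> K - {-1}" using s by (auto intro: K_intros)
  qed
  finally have "?F 1 + (\<Sum>r\<in>K. ?F (r + \<iota>)) = g 1 + (\<Sum>s\<in>K - {0}. (eta s + eta (1 - s)) * g (1 - s))"
    by (simp only: F1)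
  \<comment> \<open>The line through 1 supplies exactly the missing term s = 0.\<close>
  also have "\<dots> = (\<Sum>s\<in>K. (eta s + eta (1 - s)) * g (1 - s))"
    using K_0 by (simp add: sum.remove[of K 0])
  finally show ?thesis using sum_projective_line[of ?F] inv by simp
qed

definition eta_sum :: "'a \<Rightarrow> complex" where "eta_sum D = (\<Sum>s\<in>K. eta s * \<psi> (D * (s + 1) ^ 2))"
definition quartic_sum :: "'a \<Rightarrow> complex" where "quartic_sum D = (\<Sum>x\<in>K. \<psi> (D * (x ^ 4 - x ^ 2)))"

text \<open>Since 2 - s = -(s + 1), the substitution s -> 1 - s preserves (s + 1)^2 and exchanges
  the two characters.\<close>

lemma rho_sum_eq_eta_sum: "rho_sum D = (of_nat q - 1) * eta_sum D"
proof -
  have sq: "(1 - s + 1) ^ 2 = (s + 1) ^ 2" "(2 - s) ^ 2 = (s + 1) ^ 2" for s :: 'a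
    by (rule char3[where X = "1 - 2 * s"], simp add: algebra_simps power2_eq_square)+
  have "(\<Sum>s\<in>K. eta (1 - s) * \<psi> (D * (s + 1) ^ 2)) = eta_sum D"
    unfolding eta_sum_def
    by (rule sum.reindex_bij_witness[of _ "\<lambda>s. 1 - s" "\<lambda>s. 1 - s"]) (auto simp: sq intro: K_intros)
  hence "(\<Sum>s\<in>K. (eta s + eta (1 - s)) * \<psi> (D * (1 - s + 1) ^ 2)) = 2 * eta_sum D"
    by (simp only: sq distrib_right sum.distrib eta_sum_def mult_2)
  thus ?thesis using rho_sum_eq_sum_squares[of D] sum_eta_Nm_tn_ratio[of "\<lambda>x. \<psi> (D * (x + 1) ^ 2)"] by simp
qed

text \<open>Write \<open>eta\<close> s as (1 + \<open>eta\<close> s) - 1: the first part is a sum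
  over s = x^2, where (x^2 + 1)^2 = 1 + x^4 - x^2, the second a shifted Gauss sum.\<close>

lemma eta_sum_eq_quartic_sum: "eta_sum D = \<psi> D * quartic_sum D - gauss D"
proof -
  have *: "D * (x ^ 2 + 1) ^ 2 = D + D * (x ^ 4 - x ^ 2)" for x
    by (rule char3[where X = "D * x ^ 2"])
       (simp add: algebra_simps power2_eq_square power4_eq_xxxx)
  have "gauss D = (\<Sum>s\<in>K. \<psi> (D * (s + 1) ^ 2))"
    unfolding gauss_def
    by (rule sum.reindex_bij_witness[of _ "\<lambda>s. s + 1" "\<lambda>s. s - 1"]) (auto intro: K_intros)
  moreover have "(\<Sum>x\<in>K. \<psi> (D * (x ^ 2 + 1) ^ 2)) = \<psi> D * quartic_sum D"
    by (simp only: * psi_add quartic_sum_def sum_distrib_left)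
  ultimately show ?thesis
    using sum_squares[of "\<lambda>s. \<psi> (D * (s + 1) ^ 2)"]
    by (simp add: distrib_right sum.distrib eta_sum_def eq_diff_eq add.commute)
qed

text \<open>
  In characteristic three the substitution $(x, y) \mapsto (x + y, x - y)$ negates
  $F(x) + F(y)$ for $F(x) = D (x^4 - x^2)$, hence $V^2$ is real.
\<close>

lemma quartic_sum_cases: "cnj (quartic_sum D) = quartic_sum D \<or> cnj (quartic_sum D) = - quartic_sum D"
proof -
  define f where "f x = D * (x ^ 4 - x ^ 2)" for x
  have f: "f (x + y) + f (x - y) = - (f x + f y)" for x y
    by (rule char3[where X = "D * (x ^ 4 + 4 * x ^ 2 * y ^ 2 + y ^ 4 - x ^ 2 - y ^ 2)"])
       (simp add: f_def algebra_simps power2_eq_square power4_eq_xxxx)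
  have a: "- ((x + y) + (x - y)) = x" "(x - y) - (x + y) = y" for x y :: 'a
    by (rule char3[where X = "- x"], simp) (rule char3[where X = "- y"], simp)
  have b: "- (x + y) + (y - x) = x" "- (x + y) - (y - x) = y" for x y :: 'a
    by (rule char3[where X = "- x"], simp) (rule char3[where X = "- y"], simp)
  have V2: "quartic_sum D ^ 2 = (\<Sum>(x, y)\<in>K \<times> K. \<psi> (f x + f y))"
    by (simp add: quartic_sum_def f_def power2_eq_square sum_product sum.cartesian_product psi_add)
  also have "\<dots> = (\<Sum>(x, y)\<in>K \<times> K. \<psi> (f (x + y) + f (x - y)))"
    \<comment> \<open>The second map inverts the first because 1/2 = -1.\<close>
    by (rule sum.reindex_bij_witness[of _ "\<lambda>(x, y). (x + y, x - y)" "\<lambda>(x, y). (- (x + y), y - x)"])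
       (auto simp only: a b mem_Sigma_iff case_prod_conv intro!: K_add K_diff K_minus)
  also have "\<dots> = cnj (quartic_sum D ^ 2)"
    unfolding V2 f by (simp add: case_prod_unfold psi_minus psi_add psi_diff)
  finally show ?thesis by (simp add: power2_eq_iff) (metis complex_cnj_cancel_iff complex_cnj_minus complex_cnj_cnj)
qed

section \<open>The sign of the Walsh coefficient\<close>

lemma sigma_cases: "sigma y = 1 \<or> sigma y = -1"
  by (simp add: sigma_def)

text \<open>The real part of the character sum contributes \<psi>(D) - \<psi>(-D) times a Gauss sum,
  up to sign. The prefactor is the same Gauss sum up to sign, and their product is -q up to
  sign.\<close>

lemma twist_value:
  fixes b c :: 'a
  assumes c: "c \<in> K" "c \<noteq> 0"
  defines "D \<equiv> Nm b / c"
  shows "twist c b = of_nat q * (\<psi> D - \<psi> (- D)) \<or> twist c b = - of_nat q * (\<psi> D - \<psi> (- D))"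
proof (cases "b = 0")
  case True
  thus ?thesis by (simp add: twist_0 D_def Nm_0)
next
  case b: False
  define e where "e = \<psi> D"
  have D: "D \<in> K" "D \<noteq> 0" using c b by (auto simp: D_def intro: K_intros)
  have q1: "of_nat q - 1 \<noteq> (0::complex)"
  proof -
    have "of_nat q - 1 = (of_nat (8 * m + 2) :: complex)" by (simp add: q_mod)
    also have "\<dots> \<noteq> 0" unfolding of_nat_eq_0_iff by simp
    finally show ?thesis .
  qed
  define \<sigma> where "\<sigma> = sigma (1 / chi b)"
  have tw: "twist c b = - gauss c * \<sigma> * (eta_sum D + cnj (eta_sum D))"
  proof -
    have "(of_nat q - 1) * twist c b = (of_nat q - 1) * (- gauss c * \<sigma> * (eta_sum D + cnj (eta_sum D)))"
      using twist_eq_rho_sum[OF c b] unfolding D_def[symmetric] rho_sum_eq_eta_sum \<sigma>_def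
      by (simp add: algebra_simps)
    thus ?thesis using q1 by (simp only: mult_cancel_left simp_thms)
  qed
  have refl: "eta_sum D = - e * cnj (eta_sum D)"
  proof -
    have "(of_nat q - 1) * eta_sum D = (of_nat q - 1) * (- e * cnj (eta_sum D))"
      using rho_sum_reflect[of D] unfolding rho_sum_eq_eta_sum e_def by (simp add: algebra_simps)
    thus ?thesis using q1 by (simp only: mult_cancel_left simp_thms)
  qed
  have "gauss D = eta (D / c) * gauss c"
    using gauss_mult[OF c, of "D / c"] c D by (simp add: K_divide)
  moreover have "D / c \<in> K" "D / c \<noteq> 0" using c D by (auto intro: K_intros)
  ultimately have gD: "gauss c = gauss D \<or> gauss c = - gauss D"
    by (metis eta_cases minus_minus mult_1 mult_minus1)
  show ?thesis
  \<comment> \<open>For e = 1 the reflection makes \<open>eta_sum\<close> D purely imaginary, so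
    both sides vanish; otherwise e is a primitive cube root of unity.\<close>
  proof (cases "e = 1")
    case True
    thus ?thesis using refl tw psi_minus[of D] by (simp add: e_def) (metis add.left_inverse mult_zero_right)
  next
    case False
    have "e ^ 3 = 1" by (simp add: e_def psi_pow3)
    moreover have "(e - 1) * (e ^ 2 + e + 1) = e ^ 3 - 1"
      by (simp add: algebra_simps power2_eq_square power3_eq_cube)
    ultimately have "(e - 1) * (e ^ 2 + e + 1) = 0" by simp
    hence e: "e ^ 2 + e + 1 = 0" using False by simp
    have "e * cnj e = 1" using psi_minus_mult[of D] by (simp add: e_def psi_minus mult.commute)
    hence "e * (cnj e - e ^ 2) = 0"
      using \<open>e ^ 3 = 1\<close> by (simp add: right_diff_distrib power2_eq_square power3_eq_cube mult.assoc)
    hence ce: "cnj e = e ^ 2" using psi_nz[of D] by (simp add: e_def)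
    define X where "X = e - e ^ 2"
    have "eta_sum D + cnj (eta_sum D) = X * gauss D \<or> eta_sum D + cnj (eta_sum D) = - X * gauss D"
      unfolding X_def by (rule cube_root_identity[OF e ce _ refl quartic_sum_cases])
         (use D in \<open>auto simp: eta_sum_eq_quartic_sum e_def cnj_gauss gauss_minus\<close>)
    moreover have "\<sigma> = 1 \<or> \<sigma> = -1" by (simp add: \<sigma>_def sigma_cases)
    ultimately have "twist c b = X * gauss D ^ 2 \<or> twist c b = - (X * gauss D ^ 2)"
      using gD unfolding tw power2_eq_square by (elim disjE) simp_all
    moreover have "\<psi> D - \<psi> (- D) = X" using ce by (simp add: psi_minus e_def X_def)
    ultimately show ?thesis using gauss_sq[OF D] by (auto simp: mult.commute)
  qed
qed

text \<open>Twice the sum is -q (\<psi>(D) + \<psi>(-D)) plus the twisted sum q (\<psi>(D) -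
  \<psi>(-D)) up to sign, so one of the two character values cancels.\<close>

theorem character_sum:
  assumes c: "c \<in> K" "c \<noteq> 0"
  obtains d where "(\<Sum>x\<in>UNIV. \<psi> ((if chi x = 1 \<or> chi x = \<iota> then - c else c) * Nm x + Tr (b * x)))
      = - of_nat q * \<psi> d"
proof -
  define S where "S = (\<Sum>x\<in>UNIV. \<psi> ((if chi x = 1 \<or> chi x = \<iota> then - c else c) * Nm x + Tr (b * x)))"
  define D where "D = Nm b / c"
  have "2 * S = (\<Sum>x\<in>UNIV. (\<psi> (- c * Nm x + Tr (b * x)) + \<psi> (- (- c) * Nm x + Tr (b * x)))
      + eps x * (\<psi> (- c * Nm x) - \<psi> (c * Nm x)) * \<psi> (Tr (b * x)))"
    unfolding S_def sum_distrib_left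
    by (intro sum.cong refl) (simp add: psi_add psi_minus psi_diff eps_def algebra_simps)
  also have "\<dots> = - of_nat q * \<psi> D - of_nat q * \<psi> (- D) + twist c b"
    using norm_form_sum[OF c, of b] norm_form_sum[of "- c" b] c
    by (simp only: sum.distrib twist_def) (simp add: K_minus D_def)
  finally have S: "2 * S = - of_nat q * \<psi> D - of_nat q * \<psi> (- D) + twist c b" .
  have "S = - of_nat q * \<psi> (- D) \<or> S = - of_nat q * \<psi> D"
    using twist_value[OF c, of b] S unfolding D_def[symmetric]
  proof (elim disjE)
    assume "twist c b = of_nat q * (\<psi> D - \<psi> (- D))"
    with S have "2 * S = 2 * (- of_nat q * \<psi> (- D))" by (simp add: algebra_simps)
    thus ?thesis by simp
  next
    assume "twist c b = - of_nat q * (\<psi> D - \<psi> (- D))"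
    with S have "2 * S = 2 * (- of_nat q * \<psi> D)" by (simp add: algebra_simps)
    thus ?thesis by simp
  qed
  thus thesis using that unfolding S_def by blast
qed

end

section \<open>Reduction of the Walsh transform of f to the character sum\<close>

theorem theorem1p4:
  fixes k n :: nat and \<xi> a :: "'a::finite_field" and f :: "'a \<Rightarrow> 3"
  assumes "odd k" and "k > 0" and "n = 2 * k"
    and "CARD('a) = 3 ^ n"
    and "primitive_element \<xi>"
    and "a = \<xi> ^ ((3 ^ k + 1) div 4)"
    and "f = (\<lambda>x. absolute_trace n (a * x ^ ((3 ^ n - 1) div 4 + 3 ^ k + 1)))"
  shows "weakly_regular_bent n f"
proof -
  note card = assms(4)
  define q :: nat where "q = 3 ^ k"
  obtain m where q: "q = 8 * m + 3" using three_power_odd[OF assms(1)] unfolding q_def by blast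
  have qn: "3 ^ n = q ^ 2" by (simp add: assms(3) q_def power_mult mult.commute flip: power_mult)
  define h where "h = 2 * (2 * m + 1) * (4 * m + 1)"
  have q2: "q ^ 2 = 4 * h + 1" by (simp add: q h_def algebra_simps power2_eq_square)
  have exps: "(3 ^ k + 1) div 4 = 2 * m + 1" "(3 ^ n - 1) div 4 = h"
    unfolding qn q2 by (simp_all add: q flip: q_def)
  define \<iota> where "\<iota> = \<xi> ^ h"
  define \<psi> :: "'a \<Rightarrow> complex" where "\<psi> x = omega_pow (absolute_trace n x)" for x
  have xi_nz: "\<xi> \<noteq> 0" using assms(5) by (simp add: primitive_element_def)
  have i_sq: "\<iota> ^ 2 = -1"
  proof -
    have "\<xi> * (\<iota> ^ 2) ^ 2 = \<xi> ^ (4 * h + 1)"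
      by (simp add: \<iota>_def mult.commute flip: power_mult)
    also have "\<dots> = \<xi>"
      using finite_field_power_card_eq_same[of \<xi>] by (simp add: card qn q2)
    finally have "(\<iota> ^ 2) ^ 2 = 1" using xi_nz by simp
    moreover have "h > 0" by (simp add: h_def)
    hence "\<iota> ^ 2 \<noteq> 1"
      using primitive_element_power_neq_1[OF assms(5), of "h * 2"]
      by (simp add: \<iota>_def card qn q2 flip: power_mult)
    ultimately show ?thesis using power2_eq_1_iff by blast
  qed
  have tr0: "absolute_trace n (0::'a) = 0"
    using absolute_trace_add[OF card, of 0 0] by simp
  have n: "n > 0" using assms by simp
  interpret ternary_character k m q \<iota> \<psi>
  proof
    show "q = 3 ^ k" by (rule q_def)
    show "q = 8 * m + 3" by (rule q)
    show "CARD('a) = q ^ 2" by (simp add: card qn)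
    show "\<iota> ^ 2 = -1" by (rule i_sq)
    show "\<exists>x. \<psi> x \<noteq> 1"
      using absolute_trace_nontrivial[OF card n] by (simp add: \<psi>_def omega_pow_eq_1_iff)
  qed (simp_all add: \<psi>_def absolute_trace_add[OF card] absolute_trace_cube[OF card] omega_pow_add
        omega_pow_0 tr0)
  have a: "a = \<xi> ^ (2 * m + 1)" unfolding assms(6) exps ..
  have aq: "a ^ q = \<iota> * a"
  proof -
    \<comment> \<open>Equivalently (q-1)(q+1)/4 = \<open>h\<close>.\<close>
    have "(2 * m + 1) * q = h + (2 * m + 1)" by (simp add: q h_def algebra_simps)
    thus ?thesis unfolding a \<iota>_def by (metis power_add power_mult)
  qed
  define c where "c = a * (1 + \<iota>)"
  have i_i: "\<iota> * (\<iota> * x) = - x" for x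
    by (simp flip: mult.assoc)
  \<comment> \<open>Frobenius sends a to \<iota>a and \<iota> to -\<iota>, and \<iota>(1 - \<iota>)
    = 1 + \<iota>.\<close>
  have cK: "c \<in> K"
    unfolding K_def c_def by (simp add: power_mult_distrib frob_add aq i_frob i_i algebra_simps)
  have "(1 + \<iota>) * (1 - \<iota>) = -1"
    using i_sq two_eq by (simp add: algebra_simps power2_eq_square)
  hence c0: "c \<noteq> 0" using xi_nz by (auto simp: c_def a)
  have summand: "omega_pow (f x - absolute_trace n (b * x))
      = \<psi> ((if chi x = 1 \<or> chi x = \<iota> then - c else c) * Nm x + Tr (b * x))" for x b
  proof -
    have "x ^ (h + 3 ^ k + 1) = chi x * Nm x"
      unfolding chi_def Nm_def h_def q_def[symmetric] by (simp only: power_add power_one_right mult_ac)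
    hence fx: "f x = absolute_trace n (a * (chi x * Nm x))"
      unfolding assms(7) exps by simp
    have "f x - absolute_trace n (b * x) = absolute_trace n (a * (chi x * Nm x) - b * x)"
      using absolute_trace_add[OF card, of "a * (chi x * Nm x) - b * x" "b * x"] by (simp add: fx)
    hence "omega_pow (f x - absolute_trace n (b * x)) = \<psi> (- Tr (a * (chi x * Nm x) - b * x))"
      by (simp only: \<psi>_def[symmetric] psi_Tr[symmetric])
    also have "- Tr (a * (chi x * Nm x) - b * x)
        = (if chi x = 1 \<or> chi x = \<iota> then - c else c) * Nm x + Tr (b * x)"
    proof (cases "x = 0")
      case False
      have "Nm x ^ q = Nm x" using K_Nm[of x] by (simp add: K_def)
      hence "Tr (a * (chi x * Nm x) - b * x) = a * (chi x + \<iota> * chi x ^ q) * Nm x - Tr (b * x)"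
        by (simp add: Tr_def frob_diff power_mult_distrib aq algebra_simps)
      \<comment> \<open>The factor a (\<chi> + \<iota> \<chi>^q) equals \<open>c\<close> for \<chi>
        in {1, \<iota>} and \<open>- c\<close> for \<chi> in {-1, -\<iota>}.\<close>
      thus ?thesis
        by (simp only:) (rule chi_cases[OF False]; simp add: c_def i_frob frob_minus i_i algebra_simps)
    qed (simp add: Nm_0)
    finally show ?thesis .
  qed
  have "\<exists>d. walsh n f b = - of_nat q * \<psi> d" for b
    unfolding walsh_def summand by (rule character_sum[OF cK c0, of b]) blast
  then obtain d where d: "walsh n f b = - of_nat q * \<psi> (d b)" for b by metis
  have "3 powr (- (real n / 2)) = 1 / real q"
    by (simp add: assms(3) q_def powr_minus powr_realpow field_simps)
  \<comment> \<open>As 3^(n/2) = q, the unit u = -1 removes the sign of the Walsh coefficient, and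
    the trace of \<open>d b\<close> is the dual function.\<close>
  hence "(-1) * of_real (3 powr (- (real n / 2))) * walsh n f b = omega_pow (absolute_trace n (d b))" for b
    by (simp add: d q \<psi>_def del: of_nat_add of_nat_mult)
  moreover have "(cmod (walsh n f b))\<^sup>2 = 3 ^ n" for b
  proof -
    have "(cmod (walsh n f b))\<^sup>2 = real (q ^ 2)" by (simp add: d norm_mult cmod_psi)
    thus ?thesis by (simp flip: qn)
  qed
  ultimately show ?thesis
    unfolding weakly_regular_bent_def bent_def
    by (intro conjI allI exI[of _ "-1"] exI[of _ "\<lambda>b. absolute_trace n (d b)"]) auto
qed

end
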